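(* Let $\mathbf{R}$ be the random variable on the space $R$ (with values in $K'$) obtained by parametrizing $\mathcal{M}$ through $f_\mu$, i.e. $f_\mu(\mathbf{R})=\mathbf{X}$, where the random variable $\mathbf{X}$ on $\mathcal{M}$ is assumed to have probability density function on $\mathcal{M}$ (with respect to the 2-dimensional surface measure) proportional to $\exp\left(-\frac{\chi^2(\mathbf{x})}{2}\right)$. Then the probability density function of $\mathbf{R}$ is $$p_{\mathbf{R}}(\boldsymbol\rho)=\frac{\exp\left(-\frac{\chi^2(\boldsymbol\rho)}{2}\right)\sqrt{G_\mu(\boldsymbol\rho)}}{\int_{K'}\exp\left(-\frac{\chi^2(\boldsymbol\rho)}{2}\right)\sqrt{G_\mu(\boldsymbol\rho)}\,d\boldsymbol\rho},$$ where $\chi^2(\boldsymbol\rho)=\chi^2(f_\mu(\boldsymbol\rho))$ and $G_\mu$ is the Gramian determinant $$G_\mu(\boldsymbol\rho)=\det\left(I_2+\left(\frac{\partial\mathcal{A}^*}{\partial\boldsymbol\rho}(\boldsymbol\rho)\right)^\top\frac{\partial\mathcal{A}^*}{\partial\boldsymbol\rho}(\boldsymbol\rho)\right).$$ Moreover, neglecting terms containing the second derivatives of the residuals multiplied by the residuals themselves, for all $\boldsymbol\rho\in K'$ we have $$\frac{\partial\mathcal{A}^*}{\partial\boldsymbol\rho}(\boldsymbol\rho)=-C_{\mathcal{A}}(\mathcal{A}^*(\boldsymbol\rho),\boldsymbol\rho)^{-1}\,B_{\mathcal{A}}(\mathcal{A}^*(\boldsymbol\rho),\boldsymbol\rho)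^\top\,B_{\boldsymbol\rho}(\mathcal{A}^*(\boldsymbol\rho),\boldsymbol\rho).$$
   Context: Spaces. $A=\mathbb{S}^1\times(-\pi/2,\pi/2)\times\mathbb{R}^2$ (attributables $\mathcal{A}$), $R=\mathbb{R}_{\ge 0}\times\mathbb{R}$ (pairs $\boldsymbol\rho=(\rho,\dot\rho)$), $\mathcal{X}=A\times R$ (orbits $\mathbf{x}=(\mathcal{A},\boldsymbol\rho)$; derivatives and surface measures are taken in these coordinates, locally identifying $\mathcal{X}$ with a subset of $\mathbb{R}^6$). The residuals space is $\mathbb{R}^m$, $m\ge 6$, and $F:\mathcal{X}\to\mathbb{R}^m$, $\boldsymbol\xi(\mathbf{x})=F(\mathbf{x})$, is the sufficiently smooth map giving the normalised residuals. The target function is $Q(\mathbf{x})=\frac1m\boldsymbol\xi(\mathbf{x})^\top\boldsymbol\xi(\mathbf{x})$. Put $B_{\mathcal{A}}=\frac{\partial\boldsymbol\xi}{\partial\mathcal{A}}$ (an $m\times4$ matrix), $B_{\boldsymbol\rho}=\frac{\partial\boldsymbol\xi}{\partial\boldsymbol\rho}$ (an $m\times2$ matrix), $C_{\mathcal{A}}=B_{\mathcal{A}}^\top B_{\mathcal{A}}$. Manifold Of Variations. $K'\subseteq R$ is the set of those $\boldsymbol\rho$ (in a given subset $K$ of a compact set of admissible values, the Admissible Region) for which the doubly constrained differential corrections (a Newton-type iteration on $\mathcal{A}$ for minimising $Q(\cdot,\boldsymbol\rho)$ with $\boldsymbol\rho$ fixed, with normal equation $C_{\mathcal{A}}\Delta\mathcal{A}=-B_{\mathcal{A}}^\top\boldsymbol\xi$)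 converge, to a local minimiser $\mathcal{A}^*(\boldsymbol\rho)$ of $Q(\cdot,\boldsymbol\rho)$; for such $\boldsymbol\rho$ the matrix $C_{\mathcal{A}}(\mathcal{A}^*(\boldsymbol\rho),\boldsymbol\rho)$ is invertible. The map $f_\mu(\boldsymbol\rho)=(\mathcal{A}^*(\boldsymbol\rho),\boldsymbol\rho)$ on $K'$ is at least $C^1$, and $\mathcal{M}=f_\mu(K')$ is the Manifold Of Variations, a 2-dimensional submanifold of $\mathcal{X}$ globally parametrized by $f_\mu$. For $\mathbf{x}\in\mathcal{M}$, $\chi(\mathbf{x})=\sqrt{m(Q(\mathbf{x})-Q^* )}$ with $Q^*=\min_{\boldsymbol\rho\in K'}Q(\mathcal{A}^*(\boldsymbol\rho),\boldsymbol\rho)$. Meaning of "neglecting": $\mathcal{A}^*(\boldsymbol\rho)$ satisfies the stationarity equation $g(\mathcal{A}^*(\boldsymbol\rho),\boldsymbol\rho)=\mathbf{0}$ with $g(\mathbf{x})=B_{\mathcal{A}}(\mathbf{x})^\top\boldsymbol\xi(\mathbf{x})$. In the derivatives $\frac{\partial g}{\partial\mathcal{A}}$ and $\frac{\partial g}{\partial\boldsymbol\rho}$ the terms in which second derivatives of $\boldsymbol\xi$ (with respect to $\mathcal{A},\mathcal{A}$ and $\mathcal{A},\boldsymbol\rho$ respectively) are multiplied by $\boldsymbol\xi$ are treated as zero. *)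

theory Defs
  imports "HOL-Probability.Probability"
begin

text \<open>
  An attributable is \<open>(z, \<delta>, \<alpha>', \<delta>')\<close>, where the angle \<open>\<alpha>\<close> in the circle is represented by the
  point \<open>z = cis \<alpha>\<close> of the unit circle in the complex plane.  An orbit is an attributable together
  with \<open>\<rho>\<close>, whose two components are the range and the range rate.
\<close>

type_synonym attributable = "complex \<times> real \<times> real \<times> real"
type_synonym orbit = "attributable \<times> (real^2)"
type_synonym coords = "(real^4) \<times> (real^2)"

definition attr_space :: "attributable set" where
  "attr_space = sphere 0 1 \<times> {-pi/2<..<pi/2} \<times> UNIV \<times> UNIV"

definition rho_space :: "(real^2) set" where
  "rho_space = {\<rho>. 0 \<le> \<rho> $ 1}"

text \<open>
  Coordinates.  The map \<open>attr_coord\<close> is the universal covering of the attributable space by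
  \<open>attr_dom\<close>; its local inverses are the coordinate systems in which derivatives and surface
  measures are taken.  Two of them differ locally by a constant multiple of \<open>2 * pi\<close> in the first
  coordinate, so derivatives do not depend on the choice.
\<close>

definition attr_coord :: "real^4 \<Rightarrow> attributable" where
  "attr_coord a = (cis (a $ 1), a $ 2, a $ 3, a $ 4)"

definition attr_dom :: "(real^4) set" where
  "attr_dom = {a. - pi / 2 < a $ 2 \<and> a $ 2 < pi / 2}"

definition attr_lift :: "attributable \<Rightarrow> real^4" where
  "attr_lift A = (case A of (z, d, a', d') \<Rightarrow> vector [Arg z, d, a', d'])"

definition orbit_coord :: "coords \<Rightarrow> orbit" where
  "orbit_coord p = (attr_coord (fst p), snd p)"

text \<open>
  Continuous differentiability on a set that need not be open (the space of the \<open>\<rho>\<close> has a boundary):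
  derivatives are taken within the set.
\<close>

definition C1_on :: "'a::real_normed_vector set \<Rightarrow> ('a \<Rightarrow> 'b::real_normed_vector) \<Rightarrow> bool" where
  "C1_on S f \<longleftrightarrow> (\<exists>f' :: 'a \<Rightarrow> 'a \<Rightarrow>\<^sub>L 'b.
     (\<forall>x\<in>S. (f has_derivative blinfun_apply (f' x)) (at x within S)) \<and> continuous_on S f')"

definition C2_on :: "'a::real_normed_vector set \<Rightarrow> ('a \<Rightarrow> 'b::real_normed_vector) \<Rightarrow> bool" where
  "C2_on S f \<longleftrightarrow> (\<exists>f' :: 'a \<Rightarrow> 'a \<Rightarrow>\<^sub>L 'b.
     (\<forall>x\<in>S. (f has_derivative blinfun_apply (f' x)) (at x within S)) \<and> C1_on S f')"

definition C2_residuals :: "(orbit \<Rightarrow> real^'m) \<Rightarrow> bool" where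
  "C2_residuals F \<longleftrightarrow> C2_on (attr_dom \<times> rho_space) (\<lambda>p. F (orbit_coord p))"

definition Q :: "(orbit \<Rightarrow> real^'m) \<Rightarrow> orbit \<Rightarrow> real" where
  "Q F x = (F x \<bullet> F x) / real CARD('m)"

definition dresid_attr :: "(orbit \<Rightarrow> real^'m) \<Rightarrow> real^4 \<Rightarrow> real^2 \<Rightarrow> real^4^'m" where
  "dresid_attr F a \<rho> = jacobian (\<lambda>a'. F (attr_coord a', \<rho>)) (at a)"

definition B_attr :: "(orbit \<Rightarrow> real^'m) \<Rightarrow> orbit \<Rightarrow> real^4^'m" where
  "B_attr F x = dresid_attr F (attr_lift (fst x)) (snd x)"

definition B_rho :: "(orbit \<Rightarrow> real^'m) \<Rightarrow> orbit \<Rightarrow> real^2^'m" where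
  "B_rho F x = jacobian (\<lambda>\<rho>'. F (fst x, \<rho>')) (at (snd x) within rho_space)"

definition C_attr :: "(orbit \<Rightarrow> real^'m) \<Rightarrow> orbit \<Rightarrow> real^4^4" where
  "C_attr F x = transpose (B_attr F x) ** B_attr F x"

text \<open>
  The terms of the derivatives of \<open>g = transpose B_attr *v F\<close> in which second derivatives of the
  residuals are multiplied by the residuals.  Row \<open>i\<close> of \<open>dresid_attr\<close> is the gradient of the
  \<open>i\<close>-th residual with respect to the attributable, so the product rule gives
  \<open>C_attr F x + neglected_attr F x\<close> for the derivative of \<open>g\<close> with respect to the attributable and
  \<open>transpose (B_attr F x) ** B_rho F x + neglected_rho F x\<close> for the one with respect to \<open>\<rho>\<close>.
\<close>

definition neglected_attr :: "(orbit \<Rightarrow> real^'m) \<Rightarrow> orbit \<Rightarrow> real^4^4" where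
  "neglected_attr F x =
     (\<Sum>i\<in>UNIV. (F x $ i) *\<^sub>R
        jacobian (\<lambda>a'. dresid_attr F a' (snd x) $ i) (at (attr_lift (fst x))))"

definition neglected_rho :: "(orbit \<Rightarrow> real^'m) \<Rightarrow> orbit \<Rightarrow> real^2^4" where
  "neglected_rho F x =
     (\<Sum>i\<in>UNIV. (F x $ i) *\<^sub>R
        jacobian (\<lambda>\<rho>'. dresid_attr F (attr_lift (fst x)) \<rho>' $ i) (at (snd x) within rho_space))"

text \<open>
  Doubly constrained differential corrections with \<open>\<rho>\<close> fixed, started at the attributable \<open>A0\<close>.
  The corrections are added in coordinates, i.e. the angle is corrected modulo \<open>2 * pi\<close>.
\<close>

definition dc_converges_to ::
  "(orbit \<Rightarrow> real^'m) \<Rightarrow> real^2 \<Rightarrow> attributable \<Rightarrow> attributable \<Rightarrow> bool" where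
  "dc_converges_to F \<rho> A0 A \<longleftrightarrow> A \<in> attr_space \<and> (\<exists>s a.
     attr_coord (s 0) = A0 \<and> attr_coord a = A \<and> s \<longlonglongrightarrow> a \<and>
     (\<forall>k. s k \<in> attr_dom \<and>
          invertible (C_attr F (attr_coord (s k), \<rho>)) \<and>
          C_attr F (attr_coord (s k), \<rho>) *v (s (Suc k) - s k) =
            - (transpose (B_attr F (attr_coord (s k), \<rho>)) *v F (attr_coord (s k), \<rho>))))"

definition local_minimiser :: "(orbit \<Rightarrow> real^'m) \<Rightarrow> real^2 \<Rightarrow> attributable \<Rightarrow> bool" where
  "local_minimiser F \<rho> A \<longleftrightarrow> A \<in> attr_space \<and>
     (\<forall>\<^sub>F A' in at A within attr_space. Q F (A, \<rho>) \<le> Q F (A', \<rho>))"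

definition f_mu :: "(real^2 \<Rightarrow> attributable) \<Rightarrow> real^2 \<Rightarrow> orbit" where
  "f_mu Astar \<rho> = (Astar \<rho>, \<rho>)"

definition Qstar :: "(orbit \<Rightarrow> real^'m) \<Rightarrow> (real^2) set \<Rightarrow> (real^2 \<Rightarrow> attributable) \<Rightarrow> real" where
  "Qstar F K' Astar = (INF \<rho>\<in>K'. Q F (f_mu Astar \<rho>))"

definition chi ::
  "(orbit \<Rightarrow> real^'m) \<Rightarrow> (real^2) set \<Rightarrow> (real^2 \<Rightarrow> attributable) \<Rightarrow> orbit \<Rightarrow> real" where
  "chi F K' Astar x = sqrt (real CARD('m) * (Q F x - Qstar F K' Astar))"

text \<open>
  \<open>has_coord_derivative \<phi> D w W\<close>: a lift of \<open>\<phi>\<close> to coordinates, defined near \<open>w\<close>, has derivative \<open>D\<close>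
  at \<open>w\<close> within \<open>W\<close>.  Only a local lift is asked for, as \<open>\<phi>\<close> may wind around the circle.
\<close>

definition has_coord_derivative ::
  "(real^2 \<Rightarrow> orbit) \<Rightarrow> ((real^2) \<Rightarrow>\<^sub>L coords) \<Rightarrow> real^2 \<Rightarrow> (real^2) set \<Rightarrow> bool" where
  "has_coord_derivative \<phi> D w W \<longleftrightarrow> (\<exists>l.
     (l has_derivative blinfun_apply D) (at w within W) \<and>
     orbit_coord (l w) = \<phi> w \<and> (\<forall>\<^sub>F v in at w within W. orbit_coord (l v) = \<phi> v))"

definition C1_with ::
  "(real^2) set \<Rightarrow> (real^2 \<Rightarrow> orbit) \<Rightarrow> (real^2 \<Rightarrow> (real^2) \<Rightarrow>\<^sub>L coords) \<Rightarrow> bool" where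
  "C1_with W \<phi> D \<longleftrightarrow> (\<forall>w\<in>W. has_coord_derivative \<phi> (D w) w W) \<and> continuous_on W D"

text \<open>
  Parameter domains are the Borel sets in which the interior is dense, so that surfaces with boundary
  are covered.  On such a set a continuous derivative is uniquely determined by the map.
\<close>

definition param_domain :: "(real^2) set \<Rightarrow> bool" where
  "param_domain W \<longleftrightarrow> W \<in> sets borel \<and> W \<subseteq> closure (interior W)"

definition regular_param ::
  "(real^2) set \<Rightarrow> (real^2 \<Rightarrow> orbit) \<Rightarrow> (real^2 \<Rightarrow> (real^2) \<Rightarrow>\<^sub>L coords) \<Rightarrow> bool" where
  "regular_param W \<phi> D \<longleftrightarrow> param_domain W \<and> C1_with W \<phi> D \<and> inj_on \<phi> W \<and>
     (\<forall>w\<in>W. inj (blinfun_apply (D w)))"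

definition gram_det :: "((real^2) \<Rightarrow>\<^sub>L coords) \<Rightarrow> real" where
  "gram_det D = det (\<chi> i j. blinfun_apply D (axis i 1) \<bullet> blinfun_apply D (axis j 1) :: real^2^2)"

text \<open>
  The 2-dimensional surface measure of a surface \<open>M\<close> is the Borel measure on \<open>M\<close> that is given by the
  area integral in every regular parametrization of a part of \<open>M\<close>.
\<close>

definition is_surface_measure :: "orbit set \<Rightarrow> orbit measure \<Rightarrow> bool" where
  "is_surface_measure M \<sigma> \<longleftrightarrow> sets \<sigma> = sets (restrict_space borel M) \<and>
     (\<forall>W \<phi> D. regular_param W \<phi> D \<and> \<phi> ` W \<subseteq> M \<longrightarrow>
        (\<forall>E\<in>sets \<sigma>. E \<subseteq> \<phi> ` W \<longrightarrow>
           emeasure \<sigma> E = (\<integral>\<^sup>+ w\<in>{w\<in>W. \<phi> w \<in> E}. ennreal (sqrt (gram_det (D w))) \<partial>lborel)))"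

definition surface_measure :: "orbit set \<Rightarrow> orbit measure" where
  "surface_measure M = (THE \<sigma>. is_surface_measure M \<sigma>)"

text \<open>
  If \<open>D\<close> is the derivative of \<open>f_mu Astar\<close> in coordinates, its first component is the derivative
  of \<open>Astar\<close>.
\<close>

definition dAstar :: "(real^2 \<Rightarrow> (real^2) \<Rightarrow>\<^sub>L coords) \<Rightarrow> real^2 \<Rightarrow> real^2^4" where
  "dAstar D \<rho> = matrix (\<lambda>h. fst (blinfun_apply (D \<rho>) h))"

definition G_mu :: "(real^2 \<Rightarrow> (real^2) \<Rightarrow>\<^sub>L coords) \<Rightarrow> real^2 \<Rightarrow> real" where
  "G_mu D \<rho> = det (mat 1 + transpose (dAstar D \<rho>) ** dAstar D \<rho>)"

end

theory Submission
  imports Defs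
begin

text \<open>
  A regular parametrization \<open>\<phi>\<close> of a part of a graph \<open>f ` K\<close> factors as \<open>f \<circ> h\<close> with \<open>h = snd \<circ> \<phi>\<close>, so by
  the chain rule its Gramian is \<open>(det h')\<^sup>2\<close> times that of \<open>f\<close>, and the change of variables theorem shows
  that all parametrizations assign the same area.  Hence the surface measure of the graph is the image
  under \<open>f\<close> of the measure with density \<open>sqrt (gram_det D)\<close> on \<open>K\<close>, and the density of \<open>R\<close> is read off.

  The formula for the derivative of \<open>Astar\<close> comes from differentiating the stationarity equation
  \<open>g = 0\<close> along the graph.  A parameter domain may have cusps, where a derivative within the domain is not
  determined by the map; there all identities between derivatives are obtained as limits from the
  interior.
\<close>

subsection \<open>Lifts to coordinates\<close>

lemma cis_eq_imp_eq:
  assumes "cis x = cis y" and "\<bar>x - y\<bar> < 2 * pi"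
  shows "x = y"
proof -
  have "exp (\<i> * complex_of_real x) = exp (\<i> * complex_of_real y)"
    using assms(1) by (simp add: cis_conv_exp)
  then obtain n :: int where n: "\<i> * complex_of_real x = \<i> * y + (of_int (2 * n) * pi) * \<i>"
    unfolding exp_eq by blast
  have "x = y + of_int (2 * n) * pi"
    using arg_cong[OF n, of Im] by simp
  with assms(2) have "\<bar>real_of_int n\<bar> * (2 * pi) < 1 * (2 * pi)"
    by (simp add: abs_mult)
  then have "\<bar>real_of_int n\<bar> < 1"
    by (rule mult_right_less_imp_less) simp
  with \<open>x = y + of_int (2 * n) * pi\<close> show ?thesis
    by simp
qed

lemma orbit_coord_eq_iff:
  "orbit_coord p = orbit_coord q \<longleftrightarrow>
     cis (fst p $ 1) = cis (fst q $ 1) \<and> fst p $ 2 = fst q $ 2 \<and> fst p $ 3 = fst q $ 3 \<and>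
     fst p $ 4 = fst q $ 4 \<and> snd p = snd q"
  by (auto simp: orbit_coord_def attr_coord_def)

text \<open>The difference \<open>p - q\<close> is a period of the covering: only its angle entry
  can be nonzero, and that entry is a multiple of 2 pi.\<close>

lemma orbit_coord_shift:
  assumes "orbit_coord p = orbit_coord q"
  shows "orbit_coord (r + (p - q)) = orbit_coord r"
proof -
  have "cis (fst r $ 1 + (fst p $ 1 - fst q $ 1)) = cis (fst r $ 1)"
    using assms by (simp add: orbit_coord_eq_iff flip: cis_mult cis_divide)
  then show ?thesis
    using assms by (simp add: orbit_coord_eq_iff)
qed

text \<open>A nonzero period has norm at least 2 pi, because only the angle is ambiguous.\<close>

lemma orbit_coord_locally_inj:
  assumes "orbit_coord p = orbit_coord q" and "norm (p - q) < 2 * pi"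
  shows "p = q"
proof -
  have "\<bar>fst p $ 1 - fst q $ 1\<bar> \<le> norm (fst p - fst q)"
    using component_le_norm_cart[of "fst p - fst q" 1] by simp
  also have "\<dots> \<le> norm (p - q)"
    by (metis fst_diff norm_fst_le prod.collapse)
  finally have "fst p $ 1 = fst q $ 1"
    using assms by (intro cis_eq_imp_eq) (auto simp: orbit_coord_eq_iff)
  then show ?thesis
    using assms(1) unfolding orbit_coord_eq_iff by (simp add: prod_eq_iff[of p q] vec_eq_iff[of "fst p"] forall_4)
qed

lemma continuous_on_attr_coord: "continuous_on S attr_coord"
  unfolding attr_coord_def by (intro continuous_intros)

lemma isCont_attr_coord: "isCont attr_coord a"
  using continuous_on_attr_coord[of UNIV] continuous_on_eq_continuous_at by blast

lemma isCont_orbit_coord: "isCont orbit_coord p"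
proof -
  have "continuous_on UNIV orbit_coord"
    unfolding orbit_coord_def
    by (intro continuous_intros continuous_on_compose2[OF continuous_on_attr_coord[of UNIV]]) auto
  then show ?thesis
    using continuous_on_eq_continuous_at by blast
qed

text \<open>Local uniqueness of lifts: once the period \<open>l1 w - l2 w\<close> is subtracted,
  both lifts tend to the same point. Eventually they are closer than the shortest nonzero period and
  must coincide.\<close>

lemma lifts_differ_by_constant:
  fixes l1 l2 :: "'a::t2_space \<Rightarrow> coords"
  assumes "continuous (at w within W) l1" and "continuous (at w within W) l2"
    and "orbit_coord (l1 w) = orbit_coord (l2 w)"
    and "\<forall>\<^sub>F v in at w within W. orbit_coord (l1 v) = orbit_coord (l2 v)"
  shows "\<forall>\<^sub>F v in at w within W. l1 v = l2 v + (l1 w - l2 w)"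
proof -
  have "((\<lambda>v. l1 v - (l2 v + (l1 w - l2 w))) \<longlongrightarrow> l1 w - (l2 w + (l1 w - l2 w))) (at w within W)"
    using assms(1,2) unfolding continuous_within by (intro tendsto_intros)
  then have "((\<lambda>v. l1 v - (l2 v + (l1 w - l2 w))) \<longlongrightarrow> 0) (at w within W)"
    by simp
  then have "\<forall>\<^sub>F v in at w within W. norm (l1 v - (l2 v + (l1 w - l2 w))) < 2 * pi"
    by (rule order_tendstoD(2)[OF tendsto_norm_zero]) simp
  with assms(4) show ?thesis
  proof eventually_elim
    case (elim v)
    then show ?case
      using orbit_coord_shift[OF assms(3), of "l2 v"] by (intro orbit_coord_locally_inj) auto
  qed
qed

text \<open>Translating a lift by a period changes neither the covered map nor the derivative, so
  the point over \<open>\<phi> w\<close> can be prescribed.\<close>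

lemma has_coord_derivative_lift_at:
  assumes "has_coord_derivative \<phi> D w W" and "orbit_coord p = \<phi> w"
  obtains l where "(l has_derivative blinfun_apply D) (at w within W)" and "l w = p"
    and "\<forall>\<^sub>F v in at w within W. orbit_coord (l v) = \<phi> v"
proof -
  obtain l where l: "(l has_derivative blinfun_apply D) (at w within W)" "orbit_coord (l w) = \<phi> w"
    "\<forall>\<^sub>F v in at w within W. orbit_coord (l v) = \<phi> v"
    using assms(1) unfolding has_coord_derivative_def by blast
  show thesis
  proof
    show "((\<lambda>v. l v + (p - l w)) has_derivative blinfun_apply D) (at w within W)"
      using has_derivative_add_const[OF l(1)] .
    show "l w + (p - l w) = p"
      by simp
    have "orbit_coord (l v + (p - l w)) = orbit_coord (l v)" for v
      using assms(2) l(2) by (intro orbit_coord_shift) simp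
    then show "\<forall>\<^sub>F v in at w within W. orbit_coord (l v + (p - l w)) = \<phi> v"
      using l(3) by simp
  qed
qed

text \<open>Lifts through a common point agree near \<open>w\<close>, which reduces the claim to
  uniqueness of ordinary derivatives at an interior point.\<close>

lemma has_coord_derivative_unique:
  assumes "has_coord_derivative \<phi> D1 w W" and "has_coord_derivative \<phi> D2 w W"
    and "w \<in> interior W"
  shows "D1 = D2"
proof -
  obtain l1 where l1: "(l1 has_derivative blinfun_apply D1) (at w within W)"
    "orbit_coord (l1 w) = \<phi> w" "\<forall>\<^sub>F v in at w within W. orbit_coord (l1 v) = \<phi> v"
    using assms(1) unfolding has_coord_derivative_def by blast
  obtain l2 where l2: "(l2 has_derivative blinfun_apply D2) (at w within W)" "l2 w = l1 w"
    "\<forall>\<^sub>F v in at w within W. orbit_coord (l2 v) = \<phi> v"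
    using has_coord_derivative_lift_at[OF assms(2) l1(2)] .
  have "\<forall>\<^sub>F v in at w within W. orbit_coord (l1 v) = orbit_coord (l2 v)"
    using l1(3) l2(3) by eventually_elim simp
  then have "\<forall>\<^sub>F v in at w within W. l1 v = l2 v"
    using lifts_differ_by_constant[of w W l1 l2] has_derivative_continuous[OF l1(1)]
      has_derivative_continuous[OF l2(1)] l2(2) by simp
  then have "(l2 has_derivative blinfun_apply D1) (at w within W)"
    by (rule has_derivative_transform_eventually[OF l1(1)])
      (use l2(2) interior_subset assms(3) in auto)
  then have "blinfun_apply D1 = blinfun_apply D2"
    using l2(1) unfolding at_within_interior[OF assms(3)] by (rule has_derivative_unique)
  then show ?thesis
    by (rule blinfun_apply_inject[THEN iffD1])
qed

lemma has_coord_derivative_continuous: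
  assumes "has_coord_derivative \<phi> D w W"
  shows "continuous (at w within W) \<phi>"
proof -
  obtain l where l: "(l has_derivative blinfun_apply D) (at w within W)" "orbit_coord (l w) = \<phi> w"
    "\<forall>\<^sub>F v in at w within W. orbit_coord (l v) = \<phi> v"
    using assms unfolding has_coord_derivative_def by blast
  have "((\<lambda>v. orbit_coord (l v)) \<longlongrightarrow> orbit_coord (l w)) (at w within W)"
    using has_derivative_continuous[OF l(1)] isCont_orbit_coord
    unfolding continuous_within by (blast intro: isCont_tendsto_compose[OF isCont_orbit_coord])
  then show ?thesis
    unfolding continuous_within l(2) using l(3) by (rule Lim_transform_eventually)
qed

lemma has_coord_derivative_snd:
  assumes "has_coord_derivative \<phi> D w W" and "w \<in> W"
  shows "((\<lambda>v. snd (\<phi> v)) has_derivative (\<lambda>k. snd (blinfun_apply D k))) (at w within W)"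
proof -
  have snd_coord: "snd (orbit_coord p) = snd p" for p
    by (simp add: orbit_coord_def)
  obtain l where l: "(l has_derivative blinfun_apply D) (at w within W)" "orbit_coord (l w) = \<phi> w"
    "\<forall>\<^sub>F v in at w within W. orbit_coord (l v) = \<phi> v"
    using assms(1) unfolding has_coord_derivative_def by blast
  have "\<forall>\<^sub>F v in at w within W. snd (l v) = snd (\<phi> v)"
    using l(3) by eventually_elim (metis snd_coord)
  moreover have "snd (l w) = snd (\<phi> w)"
    by (metis l(2) snd_coord)
  ultimately show ?thesis
    using has_derivative_transform_eventually[OF has_derivative_snd[OF l(1)], of "\<lambda>v. snd (\<phi> v)"]
      assms(2) by simp
qed

lemma has_coord_derivative_compose:
  assumes "has_coord_derivative f D (h w) V" and "(h has_derivative blinfun_apply H) (at w within W)"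
    and "h ` W \<subseteq> V"
  shows "has_coord_derivative (\<lambda>v. f (h v)) (D o\<^sub>L H) w W"
proof -
  obtain l where l: "(l has_derivative blinfun_apply D) (at (h w) within V)"
    "orbit_coord (l (h w)) = f (h w)" "\<forall>\<^sub>F v in at (h w) within V. orbit_coord (l v) = f v"
    using assms(1) unfolding has_coord_derivative_def by blast
  have der: "((\<lambda>v. l (h v)) has_derivative (\<lambda>k. blinfun_apply D (blinfun_apply H k))) (at w within W)"
    using assms(2) has_derivative_subset[OF l(1) assms(3)] by (rule has_derivative_in_compose)
  obtain U where U: "open U" "h w \<in> U"
    "\<And>v. v \<in> U \<Longrightarrow> v \<in> V \<Longrightarrow> v \<noteq> h w \<Longrightarrow> orbit_coord (l v) = f v"
    using l(3) unfolding eventually_at_topological by blast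
  have "\<forall>\<^sub>F v in at w within W. h v \<in> U"
    using has_derivative_continuous[OF assms(2)] U(1,2) unfolding continuous_within
    by (rule topological_tendstoD)
  moreover have "\<forall>\<^sub>F v in at w within W. v \<in> W"
    by (simp add: eventually_at_filter)
  ultimately have ev: "\<forall>\<^sub>F v in at w within W. orbit_coord (l (h v)) = f (h v)"
  proof eventually_elim
    case (elim v)
    then have "h v \<in> V"
      using assms(3) by auto
    \<comment> \<open>\<open>U(3)\<close> speaks only of points other than \<open>h w\<close>; where
      \<open>h v = h w\<close>, the exact value of the lift at its base point is used
      instead.\<close>
    with elim U(3) l(2) show ?case
      by (cases "h v = h w") auto
  qed
  show ?thesis
    using der ev l(2) unfolding has_coord_derivative_def by (intro exI[of _ "\<lambda>v. l (h v)"]) (auto simp: o_def blinfun_compose.rep_eq)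
qed

text \<open>Every remaining point of \<open>W\<close> is a limit point of the interior, and there
  both functions have the same limit. This carries derivative identities to cusps and other boundary
  points.\<close>

lemma continuous_on_eq_from_interior:
  fixes f g :: "'a::topological_space \<Rightarrow> 'b::t2_space"
  assumes "continuous_on W f" and "continuous_on W g" and "W \<subseteq> closure (interior W)"
    and "\<And>w. w \<in> interior W \<Longrightarrow> f w = g w" and "w \<in> W"
  shows "f w = g w"
proof (cases "w \<in> interior W")
  case False
  then have "w islimpt interior W"
    using assms(3,5) by (auto simp: closure_def)
  then have nontriv: "at w within interior W \<noteq> bot"
    by (simp add: trivial_limit_within)
  have tends: "(u \<longlongrightarrow> u w) (at w within interior W)" if "continuous_on W u" for u :: "'a \<Rightarrow> 'b"
  proof (rule tendsto_within_subset[OF _ interior_subset])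
    show "(u \<longlongrightarrow> u w) (at w within W)"
      using that assms(5) by (simp add: continuous_on_def)
  qed
  have "\<forall>\<^sub>F v in at w within interior W. f v = g v"
    using assms(4) by (simp add: eventually_at_filter)
  with tends[OF assms(1)] have "(g \<longlongrightarrow> f w) (at w within interior W)"
    by (rule Lim_transform_eventually)
  then show ?thesis
    using tends[OF assms(2)] by (rule tendsto_unique[OF nontriv])
qed (use assms(4) in auto)

subsection \<open>Change of variables\<close>

text \<open>
  The library version asks for an integrable integrand; it is applied here to the truncations \<open>T n\<close>.
\<close>

lemma nn_integral_change_of_variables:
  fixes g :: "real^'n::{finite,wellorder} \<Rightarrow> real^'n::_" and f :: "real^'n::_ \<Rightarrow> real"
  assumes S: "S \<in> sets lebesgue"
    and der: "\<And>x. x \<in> S \<Longrightarrow> (g has_derivative g' x) (at x within S)"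
    and inj: "inj_on g S"
    and f: "f \<in> borel_measurable lebesgue" and nonneg: "\<And>y. 0 \<le> f y"
  shows "(\<integral>\<^sup>+x\<in>S. ennreal (\<bar>det (matrix (g' x))\<bar> * f (g x)) \<partial>lebesgue) = (\<integral>\<^sup>+y\<in>g ` S. ennreal (f y) \<partial>lebesgue)"
proof -
  have gS: "g ` S \<in> sets lebesgue"
    using der by (intro differentiable_image_in_sets_lebesgue[OF S])
      (auto simp: differentiable_on_def differentiable_def)
  \<comment> \<open>Cutting both the height and the support at \<open>n\<close> makes
    \<open>T n\<close> absolutely integrable even if \<open>f\<close> is not. Monotone convergence
    removes the cuts at the end.\<close>
  define T where "T n y = min (f y) (real n) * indicator (cball 0 (real n)) y" for n :: nat and y
  have T_nonneg: "0 \<le> T n y" for n y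
    using nonneg by (simp add: T_def)
  have T_mono: "T m y \<le> T n y" if "m \<le> n" for m n y
    using that nonneg[of y] by (auto simp: T_def indicator_def min_le_iff_disj)
  have T_lim: "(SUP n. ennreal (T n y)) = ennreal (f y)" for y
  proof (rule antisym)
    show "(SUP n. ennreal (T n y)) \<le> ennreal (f y)"
      using nonneg[of y] by (intro SUP_least ennreal_leI) (auto simp: T_def indicator_def)
    \<comment> \<open>For such an \<open>n\<close> neither cut acts at \<open>y\<close>, so the
      supremum is attained.\<close>
    obtain n :: nat where "max (norm y) (f y) \<le> real n"
      using real_arch_simple by blast
    then have "f y = T n y"
      by (auto simp: T_def)
    then show "ennreal (f y) \<le> (SUP n. ennreal (T n y))"
      by (metis SUP_upper UNIV_I)
  qed
  have T_ae: "T n absolutely_integrable_on g ` S" for n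
  proof (rule measurable_bounded_by_integrable_imp_absolutely_integrable[where g = "\<lambda>y. real n * indicator (cball 0 (real n)) y"])
    have "T n \<in> borel_measurable lebesgue"
      unfolding T_def using f by (intro borel_measurable_times borel_measurable_min borel_measurable_indicator) auto
    then show "T n \<in> borel_measurable (lebesgue_on (g ` S))"
      by (rule measurable_restrict_space1)
    have "(\<lambda>y. real n * indicator (cball 0 (real n)) y) absolutely_integrable_on UNIV"
      unfolding set_integrable_def by (simp flip: lmeasurable_iff_integrable)
    then have "(\<lambda>y. real n * indicator (cball 0 (real n)) y) absolutely_integrable_on (g ` S)"
      by (rule set_integrable_subset) (use gS in auto)
    then show "(\<lambda>y. real n * indicator (cball 0 (real n)) y) integrable_on (g ` S)"
      using set_lebesgue_integral_eq_integral(1) by blast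
    show "norm (T n y) \<le> real n * indicator (cball 0 (real n)) y" for y
      using nonneg[of y] by (auto simp: T_def indicator_def)
  qed (use gS in auto)
  let ?J = "\<lambda>x. \<bar>det (matrix (g' x))\<bar>"
  have JT_ae: "(\<lambda>x. ?J x * T n (g x)) absolutely_integrable_on S"
    and T_int: "integral S (\<lambda>x. ?J x * T n (g x)) = integral (g ` S) (T n)" for n
  proof -
    \<comment> \<open>The theorem used is about vector-valued integrands, so the scalar function is
      wrapped in \<open>real^1\<close>.\<close>
    have "(\<lambda>x. ?J x *\<^sub>R (vec (T n (g x)) :: real^1)) absolutely_integrable_on S \<and>
        integral S (\<lambda>x. ?J x *\<^sub>R (vec (T n (g x)) :: real^1)) = vec (integral (g ` S) (T n))"
      using has_absolute_integral_change_of_variables[OF S der inj, of "\<lambda>y. vec (T n y) :: real^1"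
          "vec (integral (g ` S) (T n))"] T_ae[of n]
      by (simp add: absolutely_integrable_on_1_iff integral_on_1_eq)
    then show "(\<lambda>x. ?J x * T n (g x)) absolutely_integrable_on S"
      "integral S (\<lambda>x. ?J x * T n (g x)) = integral (g ` S) (T n)"
      by (simp_all add: absolutely_integrable_on_1_iff integral_on_1_eq vec_eq_iff)
  qed
  \<comment> \<open>\<open>integral\<close> is the gauge integral; for nonnegative absolutely
    integrable functions it agrees with the nonnegative Lebesgue integral.\<close>
  have nn: "(\<integral>\<^sup>+x. ennreal (indicator A x * u x) \<partial>lebesgue) = ennreal (integral A u)"
    if "u absolutely_integrable_on A" "\<And>x. 0 \<le> u x" for A and u :: "real^'n::{finite,wellorder} \<Rightarrow> real"
    using nn_integral_has_integral_lebesgue[of A u "integral A u"] that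
      set_lebesgue_integral_eq_integral(1)[OF that(1)]
    by (simp add: nn_integral_completion has_integral_integral)
  \<comment> \<open>The constant \<open>c\<close> will be the Jacobian factor on the domain side and
    1 on the image side.\<close>
  have sup_out: "indicator A y * (ennreal c * ennreal (f z)) = (SUP n. ennreal (indicator A y * (c * T n z)))"
    if "0 \<le> c" for A :: "(real^'n::{finite,wellorder}) set" and y z c
    using that T_nonneg by (simp add: T_lim[symmetric] SUP_mult_left_ennreal ennreal_mult' indicator_def)
  have "(\<integral>\<^sup>+x\<in>S. ennreal (?J x * f (g x)) \<partial>lebesgue)
      = (\<integral>\<^sup>+x. (SUP n. ennreal (indicator S x * (?J x * T n (g x)))) \<partial>lebesgue)"
    by (subst sup_out[symmetric]) (simp_all add: ennreal_mult' nonneg mult.commute)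
  also have "\<dots> = (SUP n. \<integral>\<^sup>+x. ennreal (indicator S x * (?J x * T n (g x))) \<partial>lebesgue)"
  proof (rule nn_integral_monotone_convergence_SUP)
    show "incseq (\<lambda>n x. ennreal (indicator S x * (?J x * T n (g x))))"
      by (auto simp: incseq_def le_fun_def intro!: ennreal_leI mult_left_mono T_mono)
    show "(\<lambda>x. ennreal (indicator S x * (?J x * T n (g x)))) \<in> borel_measurable lebesgue" for n
      using JT_ae[of n] unfolding set_integrable_def by (auto dest: borel_measurable_integrable)
  qed
  also have "\<dots> = (SUP n. \<integral>\<^sup>+y. ennreal (indicator (g ` S) y * T n y) \<partial>lebesgue)"
    using nn[OF JT_ae] nn[OF T_ae] T_int T_nonneg by simp
  also have "\<dots> = (\<integral>\<^sup>+y. (SUP n. ennreal (indicator (g ` S) y * T n y)) \<partial>lebesgue)"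
  proof (rule nn_integral_monotone_convergence_SUP[symmetric])
    show "incseq (\<lambda>n y. ennreal (indicator (g ` S) y * T n y))"
      by (auto simp: incseq_def le_fun_def intro!: ennreal_leI mult_left_mono T_mono)
    show "(\<lambda>y. ennreal (indicator (g ` S) y * T n y)) \<in> borel_measurable lebesgue" for n
      using T_ae[of n] unfolding set_integrable_def by (auto dest: borel_measurable_integrable)
  qed
  also have "\<dots> = (\<integral>\<^sup>+y\<in>g ` S. ennreal (f y) \<partial>lebesgue)"
    using sup_out[of 1] by (simp add: mult.commute)
  finally show ?thesis .
qed

subsection \<open>Surface measure of a graph\<close>

lemma gram_det_eq:
  "gram_det D =
     (blinfun_apply D (axis 1 1) \<bullet> blinfun_apply D (axis 1 1)) *
       (blinfun_apply D (axis 2 1) \<bullet> blinfun_apply D (axis 2 1))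
     - (blinfun_apply D (axis 1 1) \<bullet> blinfun_apply D (axis 2 1))\<^sup>2"
  by (simp add: gram_det_def det_2 power2_eq_square inner_commute)

lemma gram_det_nonneg: "0 \<le> gram_det D"
  using Cauchy_Schwarz_ineq[of "blinfun_apply D (axis 1 1)" "blinfun_apply D (axis 2 1)"]
  by (simp add: gram_det_eq)

text \<open>If \<open>G\<close> is the Gram matrix of \<open>D\<close>, that of the composition is
  \<open>H^T G H\<close>, whence the squared determinant. In dimension two this is checked by
  expanding in the standard basis.\<close>

lemma gram_det_compose:
  "gram_det (D o\<^sub>L H) = (det (matrix (blinfun_apply H)))\<^sup>2 * gram_det D"
proof -
  have expand: "blinfun_apply D x = (x $ 1) *\<^sub>R blinfun_apply D (axis 1 1) + (x $ 2) *\<^sub>R blinfun_apply D (axis 2 1)" for x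
  proof -
    have "x = (x $ 1) *\<^sub>R axis 1 1 + (x $ 2) *\<^sub>R axis 2 1"
      by (simp add: vec_eq_iff forall_2 axis_def)
    then show ?thesis
      by (metis blinfun.add_right blinfun.scaleR_right)
  qed
  define a b where "a = blinfun_apply D (axis 1 1)" and "b = blinfun_apply D (axis 2 1)"
  show ?thesis
    unfolding gram_det_eq blinfun_apply_blinfun_compose det_2 matrix_def
    by (simp add: expand[of "blinfun_apply H _"] inner_commute[of b a] flip: a_def b_def)
      (simp add: inner_add_left inner_add_right inner_commute[of b a] algebra_simps power2_eq_square)
qed

lemma continuous_on_gram_det:
  assumes "continuous_on W D"
  shows "continuous_on W (\<lambda>w. gram_det (D w))"
  unfolding gram_det_eq by (intro continuous_intros assms)

text \<open>The second components of the images of the basis vectors are the basis vectors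
  themselves and contribute the identity matrix; the first components contribute the matrix
  product.\<close>

lemma gram_det_graph:
  assumes "\<And>k. snd (blinfun_apply D k) = k"
  shows "gram_det D = det (mat 1 + transpose (matrix (\<lambda>h. fst (blinfun_apply D h))) ** matrix (\<lambda>h. fst (blinfun_apply D h)))"
proof -
  have "blinfun_apply D (axis i 1) \<bullet> blinfun_apply D (axis j 1)
      = (mat 1 + transpose (matrix (\<lambda>h. fst (blinfun_apply D h))) ** matrix (\<lambda>h. fst (blinfun_apply D h))) $ i $ j"
    for i j
  proof -
    have "blinfun_apply D (axis i 1) \<bullet> blinfun_apply D (axis j 1)
        = (if i = j then 1 else 0) + fst (blinfun_apply D (axis i 1)) \<bullet> fst (blinfun_apply D (axis j 1))"
      using assms by (simp add: inner_prod_def inner_axis_axis)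
    then show ?thesis
      by (simp add: mat_def matrix_def transpose_def matrix_matrix_mult_def inner_vec_def)
  qed
  then show ?thesis
    unfolding gram_det_def by (intro arg_cong[where f = det]) (simp add: vec_eq_iff)
qed

lemma has_coord_derivative_cong:
  assumes "\<And>v. v \<in> W \<Longrightarrow> \<phi> v = \<psi> v" and "w \<in> W" and "has_coord_derivative \<phi> D w W"
  shows "has_coord_derivative \<psi> D w W"
proof -
  have "(\<forall>\<^sub>F v in at w within W. orbit_coord (l v) = \<phi> v) \<longleftrightarrow> (\<forall>\<^sub>F v in at w within W. orbit_coord (l v) = \<psi> v)" for l
    unfolding eventually_at_filter
    by (intro arg_cong[where f = "\<lambda>P. eventually P (nhds w)"] ext) (use assms(1) in auto)
  with assms show ?thesis
    unfolding has_coord_derivative_def by simp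
qed

lemma C1_with_continuous_on:
  assumes "C1_with W \<phi> D"
  shows "continuous_on W \<phi>"
  unfolding continuous_on_eq_continuous_within
proof
  fix w assume "w \<in> W"
  then have "has_coord_derivative \<phi> (D w) w W"
    using assms by (simp add: C1_with_def)
  then show "continuous (at w within W) \<phi>"
    by (rule has_coord_derivative_continuous)
qed

text \<open>Since \<open>snd\<close> after \<open>f\<close> is the identity on \<open>K\<close>,
  uniqueness of derivatives gives the claim in the interior; continuity of \<open>D\<close> extends
  it to all of \<open>K\<close>.\<close>

lemma graph_derivative_snd:
  assumes "param_domain K" and "C1_with K f D" and graph: "\<And>\<rho>. \<rho> \<in> K \<Longrightarrow> snd (f \<rho>) = \<rho>"
    and "\<rho> \<in> K"
  shows "snd (blinfun_apply (D \<rho>) k) = k"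
proof (rule continuous_on_eq_from_interior[of K "\<lambda>\<rho>. snd (blinfun_apply (D \<rho>) k)" "\<lambda>_. k"])
  show "continuous_on K (\<lambda>\<rho>. snd (blinfun_apply (D \<rho>) k))"
    using assms(2) unfolding C1_with_def by (auto intro!: continuous_intros)
  show "K \<subseteq> closure (interior K)"
    using assms(1) by (simp add: param_domain_def)
  show "snd (blinfun_apply (D w) k) = k" if w: "w \<in> interior K" for w
  proof -
    have wK: "w \<in> K"
      using w interior_subset by auto
    have "((\<lambda>v. snd (f v)) has_derivative (\<lambda>k. snd (blinfun_apply (D w) k))) (at w within K)"
      using assms(2) wK by (intro has_coord_derivative_snd) (simp_all add: C1_with_def)
    then have "((\<lambda>v. v) has_derivative (\<lambda>k. snd (blinfun_apply (D w) k))) (at w within K)"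
      by (rule has_derivative_transform[rotated 2]) (use wK graph in auto)
    then have "(\<lambda>k. snd (blinfun_apply (D w) k)) = (\<lambda>k. k)"
      unfolding at_within_interior[OF w] by (rule has_derivative_unique) (rule has_derivative_ident)
    then show ?thesis
      by (rule fun_cong)
  qed
qed (use assms(4) in auto)

text \<open>On \<open>W\<close> the map \<open>\<phi>\<close> is \<open>f\<close> applied to its own
  second component. The chain rule and uniqueness of derivatives give the identity in the interior,
  and both sides are continuous on \<open>W\<close>.\<close>

lemma param_factors_through_graph:
  assumes "param_domain W" and "C1_with W \<phi> D'" and "C1_with K f D"
    and graph: "\<And>\<rho>. \<rho> \<in> K \<Longrightarrow> snd (f \<rho>) = \<rho>" and sub: "\<phi> ` W \<subseteq> f ` K" and "w \<in> W"
  shows "D' w = D (snd (\<phi> w)) o\<^sub>L (snd_blinfun o\<^sub>L D' w)"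
proof (rule continuous_on_eq_from_interior[of W D' "\<lambda>w. D (snd (\<phi> w)) o\<^sub>L (snd_blinfun o\<^sub>L D' w)"])
  have range: "snd (\<phi> v) \<in> K" "f (snd (\<phi> v)) = \<phi> v" if "v \<in> W" for v
    using subsetD[OF sub imageI[OF that]] graph by auto
  have contD': "continuous_on W D'"
    using assms(2) by (simp add: C1_with_def)
  have "continuous_on W (\<lambda>w. D (snd (\<phi> w)))"
  proof (rule continuous_on_compose2[of K D W "\<lambda>w. snd (\<phi> w)"])
    show "continuous_on K D"
      using assms(3) by (simp add: C1_with_def)
    show "continuous_on W (\<lambda>w. snd (\<phi> w))"
      using C1_with_continuous_on[OF assms(2)] by (rule continuous_on_snd)
  qed (use range in auto)
  then show "continuous_on W (\<lambda>w. D (snd (\<phi> w)) o\<^sub>L (snd_blinfun o\<^sub>L D' w))"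
    by (intro bounded_bilinear.continuous_on[OF bounded_bilinear_blinfun_compose] continuous_on_const contD')
  show "continuous_on W D'"
    by fact
  show "W \<subseteq> closure (interior W)"
    using assms(1) by (simp add: param_domain_def)
  fix v assume v: "v \<in> interior W"
  then have vW: "v \<in> W"
    using interior_subset by auto
  have D': "has_coord_derivative \<phi> (D' v) v W"
    using assms(2) vW by (simp add: C1_with_def)
  have "has_coord_derivative (\<lambda>u. f (snd (\<phi> u))) (D (snd (\<phi> v)) o\<^sub>L (snd_blinfun o\<^sub>L D' v)) v W"
  proof (rule has_coord_derivative_compose[where V = K])
    show "has_coord_derivative f (D (snd (\<phi> v))) (snd (\<phi> v)) K"
      using assms(3) range(1)[OF vW] by (simp add: C1_with_def)
    show "((\<lambda>u. snd (\<phi> u)) has_derivative blinfun_apply (snd_blinfun o\<^sub>L D' v)) (at v within W)"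
      using has_coord_derivative_snd[OF D' vW] by (simp add: blinfun_compose.rep_eq o_def)
    show "(\<lambda>u. snd (\<phi> u)) ` W \<subseteq> K"
      using range(1) by auto
  qed
  then have "has_coord_derivative \<phi> (D (snd (\<phi> v)) o\<^sub>L (snd_blinfun o\<^sub>L D' v)) v W"
    by (rule has_coord_derivative_cong[rotated 2]) (use range(2) vW in auto)
  with D' show "D' v = D (snd (\<phi> v)) o\<^sub>L (snd_blinfun o\<^sub>L D' v)"
    using v by (rule has_coord_derivative_unique)
qed fact

section \<open>Measurability and the area measure on a graph\<close>

lemma C1_with_vimage_borel:
  assumes "W \<in> sets borel" and "C1_with W \<phi> D" and "E \<in> sets (restrict_space borel M)" and "\<phi> ` W \<subseteq> M"
  shows "{w\<in>W. \<phi> w \<in> E} \<in> sets borel"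
proof -
  obtain B where B: "B \<in> sets borel" "E = M \<inter> B"
    using assms(3) by (auto simp: sets_restrict_space)
  have "\<phi> -` B \<inter> space (restrict_space borel W) \<in> sets (restrict_space borel W)"
    using borel_measurable_continuous_on_restrict[OF C1_with_continuous_on[OF assms(2)]] B(1)
    by (rule measurable_sets)
  moreover have "\<phi> -` B \<inter> space (restrict_space borel W) = {w\<in>W. \<phi> w \<in> E}"
    using assms(4) by (auto simp: B(2) space_restrict_space)
  ultimately show ?thesis
    using assms(1) by (simp add: sets_restrict_space_iff)
qed

text \<open>The base is restricted because \<open>f\<close> is controlled only on \<open>K\<close>,
  the target because \<open>is_surface_measure\<close> prescribes exactly these measurable
  sets.\<close>

definition graph_measure ::
  "(real^2) set \<Rightarrow> (real^2 \<Rightarrow> orbit) \<Rightarrow> (real^2 \<Rightarrow> (real^2) \<Rightarrow>\<^sub>L coords) \<Rightarrow> orbit measure" where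
  "graph_measure K f D =
     distr (density (restrict_space lborel K) (\<lambda>\<rho>. ennreal (sqrt (gram_det (D \<rho>)))))
       (restrict_space borel (f ` K)) f"

lemma sets_graph_measure [simp]: "sets (graph_measure K f D) = sets (restrict_space borel (f ` K))"
  by (simp add: graph_measure_def)

lemma space_graph_measure [simp]: "space (graph_measure K f D) = f ` K"
  by (simp add: graph_measure_def space_restrict_space)

lemma C1_with_measurable_into_image:
  assumes "C1_with K f D"
  shows "f \<in> measurable (restrict_space borel K) (restrict_space borel (f ` K))"
  using borel_measurable_continuous_on_restrict[OF C1_with_continuous_on[OF assms]]
  by (intro measurable_restrict_space2) (auto simp: space_restrict_space)

lemma measurable_sqrt_gram_det:
  assumes "C1_with K f D"
  shows "(\<lambda>\<rho>. sqrt (gram_det (D \<rho>))) \<in> borel_measurable (restrict_space borel K)"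
  using assms unfolding C1_with_def
  by (intro borel_measurable_continuous_on_restrict continuous_intros continuous_on_gram_det) auto

lemma nn_integral_graph_measure:
  assumes "K \<in> sets borel" and "C1_with K f D" and "u \<in> borel_measurable (restrict_space borel (f ` K))"
  shows "(\<integral>\<^sup>+x. u x \<partial>graph_measure K f D) = (\<integral>\<^sup>+\<rho>\<in>K. ennreal (sqrt (gram_det (D \<rho>))) * u (f \<rho>) \<partial>lborel)"
proof -
  have sets: "sets (restrict_space lborel K) = sets (restrict_space borel K)"
    by (simp add: sets_restrict_space)
  have f: "f \<in> measurable (restrict_space lborel K) (restrict_space borel (f ` K))"
    using C1_with_measurable_into_image[OF assms(2)] by (simp cong: measurable_cong_sets add: measurable_cong_sets[OF sets refl])
  have gram: "(\<lambda>\<rho>. ennreal (sqrt (gram_det (D \<rho>)))) \<in> borel_measurable (restrict_space lborel K)"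
    using measurable_sqrt_gram_det[OF assms(2)] by (simp add: measurable_cong_sets[OF sets refl])
  have "(\<integral>\<^sup>+x. u x \<partial>graph_measure K f D)
      = (\<integral>\<^sup>+\<rho>. u (f \<rho>) \<partial>density (restrict_space lborel K) (\<lambda>\<rho>. ennreal (sqrt (gram_det (D \<rho>)))))"
    unfolding graph_measure_def using f assms(3) by (intro nn_integral_distr) auto
  also have "\<dots> = (\<integral>\<^sup>+\<rho>. ennreal (sqrt (gram_det (D \<rho>))) * u (f \<rho>) \<partial>restrict_space lborel K)"
    using measurable_compose[OF f assms(3)] by (intro nn_integral_density gram) auto
  also have "\<dots> = (\<integral>\<^sup>+\<rho>\<in>K. ennreal (sqrt (gram_det (D \<rho>))) * u (f \<rho>) \<partial>lborel)"
    using assms(1) by (intro nn_integral_restrict_space) auto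
  finally show ?thesis .
qed

lemma emeasure_graph_measure:
  assumes "K \<in> sets borel" and "C1_with K f D" and E: "E \<in> sets (restrict_space borel (f ` K))"
  shows "emeasure (graph_measure K f D) E = (\<integral>\<^sup>+\<rho>\<in>{\<rho>\<in>K. f \<rho> \<in> E}. ennreal (sqrt (gram_det (D \<rho>))) \<partial>lborel)"
proof -
  have "emeasure (graph_measure K f D) E = (\<integral>\<^sup>+x. indicator E x \<partial>graph_measure K f D)"
    using E by simp
  also have "\<dots> = (\<integral>\<^sup>+\<rho>\<in>K. ennreal (sqrt (gram_det (D \<rho>))) * indicator E (f \<rho>) \<partial>lborel)"
    using E by (intro nn_integral_graph_measure assms(1,2)) auto
  also have "\<dots> = (\<integral>\<^sup>+\<rho>\<in>{\<rho>\<in>K. f \<rho> \<in> E}. ennreal (sqrt (gram_det (D \<rho>))) \<partial>lborel)"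
    by (intro nn_integral_cong) (auto simp: indicator_def)
  finally show ?thesis .
qed

text \<open>Both \<open>f\<close> and its derivative have the left inverse \<open>snd\<close>, which
  gives the two injectivity conditions.\<close>

lemma regular_param_graph:
  assumes "param_domain K" and "C1_with K f D" and "\<And>\<rho>. \<rho> \<in> K \<Longrightarrow> snd (f \<rho>) = \<rho>"
  shows "regular_param K f D"
proof -
  have "inj (blinfun_apply (D \<rho>))" if "\<rho> \<in> K" for \<rho>
    using graph_derivative_snd[OF assms that] by (metis injI)
  then show ?thesis
    using assms unfolding regular_param_def by (auto intro: inj_on_inverseI[of K snd])
qed

lemma is_surface_measure_graph:
  assumes dom: "param_domain K" and C1: "C1_with K f D" and graph: "\<And>\<rho>. \<rho> \<in> K \<Longrightarrow> snd (f \<rho>) = \<rho>"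
  shows "is_surface_measure (f ` K) (graph_measure K f D)"
  unfolding is_surface_measure_def
proof (intro conjI allI impI ballI)
  fix W \<phi> D' E
  assume "regular_param W \<phi> D' \<and> \<phi> ` W \<subseteq> f ` K" and "E \<in> sets (graph_measure K f D)" and EW: "E \<subseteq> \<phi> ` W"
  then have W: "param_domain W" "C1_with W \<phi> D'" "inj_on \<phi> W" "\<phi> ` W \<subseteq> f ` K"
    and E: "E \<in> sets (restrict_space borel (f ` K))"
    by (auto simp: regular_param_def)
  have Wb: "W \<in> sets borel" and Kb: "K \<in> sets borel"
    using W(1) dom by (auto simp: param_domain_def)
  have range: "snd (\<phi> v) \<in> K" "f (snd (\<phi> v)) = \<phi> v" if "v \<in> W" for v
    using subsetD[OF W(4) imageI[OF that]] graph by auto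
  let ?S = "{w\<in>W. \<phi> w \<in> E}" and ?h = "\<lambda>w. snd (\<phi> w)" and ?H = "\<lambda>w. snd_blinfun o\<^sub>L D' w"
  \<comment> \<open>Extension by zero outside \<open>K\<close> yields a density that is measurable
    on the whole plane, as the change of variables demands.\<close>
  let ?u = "\<lambda>\<rho>. indicator K \<rho> *\<^sub>R sqrt (gram_det (D \<rho>))"
  \<comment> \<open>Surjectivity rests on \<open>EW\<close>: a point of \<open>E\<close> has a
    parameter in \<open>W\<close>, and \<open>snd\<close> recovers the point of \<open>K\<close>
    below it.\<close>
  have image: "?h ` ?S = {\<rho>\<in>K. f \<rho> \<in> E}"
  proof (intro set_eqI iffI)
    fix \<rho> assume "\<rho> \<in> {\<rho>\<in>K. f \<rho> \<in> E}"
    moreover from this obtain w where "w \<in> W" "f \<rho> = \<phi> w"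
      using EW by auto
    ultimately show "\<rho> \<in> ?h ` ?S"
      using graph by (intro image_eqI[of _ _ w]) (auto, metis)
  qed (use range in auto)
  have u: "?u \<in> borel_measurable borel"
    using measurable_sqrt_gram_det[OF C1] Kb by (subst (asm) borel_measurable_restrict_space_iff) auto
  have S: "?S \<in> sets borel"
    using C1_with_vimage_borel[OF Wb W(2) E W(4)] .
  \<comment> \<open>The factorisation of \<open>D'\<close> turns its area density into the Jacobian
    of \<open>?h\<close> times the area density of \<open>f\<close> at \<open>?h w\<close>.\<close>
  have "(\<integral>\<^sup>+w\<in>?S. ennreal (sqrt (gram_det (D' w))) \<partial>lborel)
      = (\<integral>\<^sup>+w\<in>?S. ennreal (\<bar>det (matrix (blinfun_apply (?H w)))\<bar> * ?u (?h w)) \<partial>lborel)"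
  proof (rule nn_integral_cong)
    fix w
    show "ennreal (sqrt (gram_det (D' w))) * indicator ?S w
        = ennreal (\<bar>det (matrix (blinfun_apply (?H w)))\<bar> * ?u (?h w)) * indicator ?S w"
    proof (cases "w \<in> ?S")
      case True
      then have "D' w = D (?h w) o\<^sub>L ?H w"
        using param_factors_through_graph[OF W(1,2) C1 graph W(4)] by auto
      then have "gram_det (D' w) = (det (matrix (blinfun_apply (?H w))))\<^sup>2 * gram_det (D (?h w))"
        by (metis gram_det_compose)
      with True range(1) show ?thesis
        by (simp add: real_sqrt_mult)
    qed simp
  qed
  also have "\<dots> = (\<integral>\<^sup>+w\<in>?S. ennreal (\<bar>det (matrix (blinfun_apply (?H w)))\<bar> * ?u (?h w)) \<partial>lebesgue)"
    by (simp add: nn_integral_completion)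
  also have "\<dots> = (\<integral>\<^sup>+\<rho>\<in>?h ` ?S. ennreal (?u \<rho>) \<partial>lebesgue)"
  proof (rule nn_integral_change_of_variables)
    show "?S \<in> sets lebesgue"
      using S by auto
    show "inj_on ?h ?S"
    proof (rule inj_onI)
      fix v w assume "v \<in> ?S" "w \<in> ?S" "?h v = ?h w"
      then show "v = w"
        using range(2) inj_onD[OF W(3)] by (metis (no_types, lifting) mem_Collect_eq)
    qed
    show "(?h has_derivative blinfun_apply (?H w)) (at w within ?S)" if "w \<in> ?S" for w
    proof (rule has_derivative_subset)
      show "(?h has_derivative blinfun_apply (?H w)) (at w within W)"
        using has_coord_derivative_snd[of \<phi> "D' w" w W] that W(2)
        by (simp add: blinfun_compose.rep_eq o_def C1_with_def)
    qed auto
    show "?u \<in> borel_measurable lebesgue"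
      using u by (simp add: measurable_completion)
  qed (simp add: gram_det_nonneg)
  also have "\<dots> = (\<integral>\<^sup>+\<rho>\<in>{\<rho>\<in>K. f \<rho> \<in> E}. ennreal (sqrt (gram_det (D \<rho>))) \<partial>lborel)"
    unfolding image nn_integral_completion by (intro nn_integral_cong) (auto simp: indicator_def)
  also have "\<dots> = emeasure (graph_measure K f D) E"
    using emeasure_graph_measure[OF Kb C1 E] by simp
  finally show "emeasure (graph_measure K f D) E = (\<integral>\<^sup>+w\<in>?S. ennreal (sqrt (gram_det (D' w))) \<partial>lborel)"
    by simp
qed simp

text \<open>The map \<open>f\<close> is itself a regular parametrization covering the whole graph,
  so the area formula with \<open>W = K\<close> fixes the measure of every measurable set. Hence the
  definite description is justified.\<close>

lemma surface_measure_graph: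
  assumes "param_domain K" and "C1_with K f D" and "\<And>\<rho>. \<rho> \<in> K \<Longrightarrow> snd (f \<rho>) = \<rho>"
  shows "surface_measure (f ` K) = graph_measure K f D"
  unfolding surface_measure_def
proof (rule the_equality)
  show "is_surface_measure (f ` K) (graph_measure K f D)"
    using assms by (rule is_surface_measure_graph)
  fix \<sigma> assume \<sigma>: "is_surface_measure (f ` K) \<sigma>"
  show "\<sigma> = graph_measure K f D"
  proof (rule measure_eqI)
    show sets: "sets \<sigma> = sets (graph_measure K f D)"
      using \<sigma> by (simp add: is_surface_measure_def)
    fix E assume E: "E \<in> sets \<sigma>"
    then have "E \<subseteq> f ` K"
      using sets sets.sets_into_space[of E "graph_measure K f D"] by simp
    with E \<sigma> regular_param_graph[OF assms]
    have "emeasure \<sigma> E = (\<integral>\<^sup>+w\<in>{w\<in>K. f w \<in> E}. ennreal (sqrt (gram_det (D w))) \<partial>lborel)"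
      unfolding is_surface_measure_def by blast
    also have "\<dots> = emeasure (graph_measure K f D) E"
      using assms(1,2) E sets by (intro emeasure_graph_measure[symmetric]) (auto simp: param_domain_def)
    finally show "emeasure \<sigma> E = emeasure (graph_measure K f D) E" .
  qed
qed

text \<open>As \<open>snd\<close> inverts \<open>f\<close>, an event about \<open>R\<close> is an
  event about \<open>X\<close>. The constant \<open>c\<close> is not presupposed to be normalising:
  total mass one forces it to be the reciprocal of the integral.\<close>

lemma distributed_graph_parameter:
  fixes q :: "orbit \<Rightarrow> real"
  assumes "prob_space P" and dom: "param_domain K" and C1: "C1_with K f D"
    and graph: "\<And>\<rho>. \<rho> \<in> K \<Longrightarrow> snd (f \<rho>) = \<rho>"
    and c: "0 < c" and q: "\<And>x. 0 \<le> q x"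
    and X: "distributed P (surface_measure (f ` K)) X (\<lambda>x. ennreal (c * q x))"
    and R: "R \<in> borel_measurable P" "\<And>\<omega>. \<omega> \<in> space P \<Longrightarrow> R \<omega> \<in> K" "\<And>\<omega>. \<omega> \<in> space P \<Longrightarrow> f (R \<omega>) = X \<omega>"
  shows "distributed P lborel R
     (\<lambda>\<rho>. ennreal (indicator K \<rho> * (q (f \<rho>) * sqrt (gram_det (D \<rho>)) /
        (LINT \<rho>':K|lborel. q (f \<rho>') * sqrt (gram_det (D \<rho>'))))))"
proof -
  interpret prob_space P by fact
  define J where "J \<rho> = indicator K \<rho> *\<^sub>R (q (f \<rho>) * sqrt (gram_det (D \<rho>)))" for \<rho>
  have Kb: "K \<in> sets borel"
    using dom by (simp add: param_domain_def)
  have surface: "surface_measure (f ` K) = graph_measure K f D"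
    by (rule surface_measure_graph[OF dom C1 graph])
  have cong: "measurable (graph_measure K f D) N = measurable (restrict_space borel (f ` K)) N" for N :: "'z measure"
    by (rule measurable_cong_sets) auto
  have q_meas: "(\<lambda>x. ennreal (c * q x)) \<in> borel_measurable (restrict_space borel (f ` K))"
    using distributed_borel_measurable[OF X] unfolding surface cong .
  have J_nonneg: "0 \<le> J \<rho>" for \<rho>
    using q by (simp add: J_def gram_det_nonneg)
  have J_meas: "J \<in> borel_measurable borel"
  proof -
    \<comment> \<open>Measurability of \<open>q\<close> is known only through the density of
      \<open>X\<close>; leaving the extended reals and dividing by \<open>c\<close> recovers it
      along the graph.\<close>
    have "(\<lambda>\<rho>. enn2real (ennreal (c * q (f \<rho>))) / c) \<in> borel_measurable (restrict_space borel K)"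
      using measurable_compose[OF C1_with_measurable_into_image[OF C1] q_meas] by measurable
    then have "(\<lambda>\<rho>. q (f \<rho>)) \<in> borel_measurable (restrict_space borel K)"
      using c q by (simp add: less_imp_le)
    then have "(\<lambda>\<rho>. q (f \<rho>) * sqrt (gram_det (D \<rho>))) \<in> borel_measurable (restrict_space borel K)"
      using measurable_sqrt_gram_det[OF C1] by (rule borel_measurable_times)
    then show ?thesis
      unfolding J_def using Kb by (subst (asm) borel_measurable_restrict_space_iff) auto
  qed
  have distr: "emeasure (distr P lborel R) A = (\<integral>\<^sup>+\<rho>\<in>A. ennreal (c * J \<rho>) \<partial>lborel)"
    if A: "A \<in> sets borel" for A
  proof -
    \<comment> \<open>The part of the graph lying over \<open>A\<close>.\<close>
    define E where "E = f ` K \<inter> snd -` A"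
    have E: "E \<in> sets (restrict_space borel (f ` K))"
      using measurable_sets[OF borel_measurable_continuous_onI[OF continuous_on_snd[OF continuous_on_id]] A]
      unfolding E_def sets_restrict_space by auto
    have "emeasure (distr P lborel R) A = emeasure P (R -` A \<inter> space P)"
      using R(1) A by (intro emeasure_distr) auto
    also have "R -` A \<inter> space P = X -` E \<inter> space P"
    proof -
      have "R \<omega> \<in> A \<longleftrightarrow> X \<omega> \<in> E" if "\<omega> \<in> space P" for \<omega>
        using R(2)[OF that] graph[OF R(2)[OF that]] unfolding R(3)[OF that, symmetric] E_def by auto
      then show ?thesis
        by auto
    qed
    also have "emeasure P (X -` E \<inter> space P) = emeasure (distr P (graph_measure K f D) X) E"
      using distributed_measurable[OF X] E by (intro emeasure_distr[symmetric]) (auto simp: surface)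
    also have "\<dots> = emeasure (density (graph_measure K f D) (\<lambda>x. ennreal (c * q x))) E"
      using distributed_distr_eq_density[OF X] by (simp add: surface)
    also have "\<dots> = (\<integral>\<^sup>+x. ennreal (c * q x) * indicator E x \<partial>graph_measure K f D)"
      using E q_meas by (intro emeasure_density) (auto simp: cong)
    also have "\<dots> = (\<integral>\<^sup>+\<rho>\<in>K. ennreal (sqrt (gram_det (D \<rho>))) * (ennreal (c * q (f \<rho>)) * indicator E (f \<rho>)) \<partial>lborel)"
      using E q_meas by (intro nn_integral_graph_measure Kb C1 borel_measurable_times_ennreal borel_measurable_indicator)
    also have "\<dots> = (\<integral>\<^sup>+\<rho>\<in>A. ennreal (c * J \<rho>) \<partial>lborel)"
      using c q graph
      by (intro nn_integral_cong)
        (auto simp: J_def E_def indicator_def gram_det_nonneg mult_ac simp flip: ennreal_mult)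
    finally show ?thesis .
  qed
  have "(\<integral>\<^sup>+\<rho>. ennreal (c * J \<rho>) \<partial>lborel) = ennreal 1"
    using distr[of UNIV] R(1) by (simp add: prob_space.emeasure_space_1[OF prob_space_distr] emeasure_distr emeasure_space_1)
  \<comment> \<open>The nonnegative integral is finite, so the Bochner integral takes its value and
    not the default 0.\<close>
  then have "(LINT \<rho>|lborel. c * J \<rho>) = 1"
    using J_meas J_nonneg c by (subst integral_eq_nn_integral) auto
  moreover have "(LINT \<rho>:K|lborel. q (f \<rho>) * sqrt (gram_det (D \<rho>))) = (LINT \<rho>|lborel. J \<rho>)"
    by (simp add: set_lebesgue_integral_def J_def)
  ultimately have total: "(LINT \<rho>:K|lborel. q (f \<rho>) * sqrt (gram_det (D \<rho>))) = 1 / c"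
    using c by (simp add: field_simps)
  have density: "indicator K \<rho> * (q (f \<rho>) * sqrt (gram_det (D \<rho>)) / (1 / c)) = c * J \<rho>" for \<rho>
    by (simp add: J_def)
  show ?thesis
    unfolding total density distributed_def
  proof (intro conjI measure_eqI)
    fix A assume "A \<in> sets (distr P lborel R)"
    then show "emeasure (distr P lborel R) A = emeasure (density lborel (\<lambda>\<rho>. ennreal (c * J \<rho>))) A"
      using distr J_meas by (subst emeasure_density) auto
  qed (use R(1) J_meas in auto)
qed

subsection \<open>Linearised stationarity equation\<close>

lemma attr_coord_in_attr_space_iff: "attr_coord a \<in> attr_space \<longleftrightarrow> a \<in> attr_dom"
  by (auto simp: attr_coord_def attr_space_def attr_dom_def)

lemma vector_4:
  "(vector [x, y, z, w] :: 'a::zero^4) $ 1 = x" "(vector [x, y, z, w] :: 'a::zero^4) $ 2 = y"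
  "(vector [x, y, z, w] :: 'a::zero^4) $ 3 = z" "(vector [x, y, z, w] :: 'a::zero^4) $ 4 = w"
  unfolding vector_def by simp_all

lemma attr_coord_attr_lift:
  assumes "A \<in> attr_space"
  shows "attr_coord (attr_lift A) = A"
proof -
  obtain z d u v where A: "A = (z, d, u, v)"
    by (metis prod.exhaust)
  then have z: "norm z = 1"
    using assms by (simp add: attr_space_def)
  then have "cis (Arg z) = z"
    by (subst cis_Arg) (auto simp: sgn_div_norm)
  then show ?thesis
    by (simp add: A attr_coord_def attr_lift_def vector_4)
qed

lemma open_attr_dom: "open attr_dom"
proof -
  have "attr_dom = (\<lambda>a. a $ 2) -` {- pi / 2<..<pi / 2}"
    by (auto simp: attr_dom_def)
  moreover have "open ((\<lambda>a::real^4. a $ 2) -` {- pi / 2<..<pi / 2})"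
    by (intro open_vimage continuous_intros)
  ultimately show ?thesis
    by simp
qed

lemma rho_space_derivative_unique:
  assumes "(f has_derivative f1) (at \<rho> within rho_space)" and "(f has_derivative f2) (at \<rho> within rho_space)"
    and "\<rho> \<in> rho_space"
  shows "f1 = f2"
proof -
  \<comment> \<open>On the boundary of the half plane, derivatives within this box are still unique.\<close>
  let ?C = "cbox \<rho> (\<rho> + (\<chi> i. 1))"
  have sub: "?C \<subseteq> rho_space"
    using assms(3) by (auto simp: rho_space_def mem_box_cart intro: order_trans)
  have pos: "\<rho> \<bullet> i < (\<rho> + (\<chi> i. 1)) \<bullet> i" if "i \<in> Basis" for i :: "real^2"
    using that by (auto simp: Basis_vec_def inner_axis)
  have "\<rho> \<in> ?C"
    by (simp add: mem_box_cart)
  then show ?thesis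
    using frechet_derivative_within_cbox[OF pos _ has_derivative_subset[OF assms(1) sub]]
      frechet_derivative_within_cbox[OF pos _ has_derivative_subset[OF assms(2) sub]] by metis
qed

lemma jacobian_eq_matrix:
  assumes "(f has_derivative f') (at x)"
  shows "jacobian f (at x) = matrix f'"
  using frechet_derivative_at[OF assms] by (simp add: jacobian_def)

text \<open>\<open>jacobian\<close> is built from a chosen derivative; uniqueness within the half
  plane pins the choice down even on the boundary.\<close>

lemma jacobian_rho_space_eq_matrix:
  assumes "(f has_derivative f') (at \<rho> within rho_space)" and "\<rho> \<in> rho_space"
  shows "jacobian f (at \<rho> within rho_space) = matrix f'"
proof -
  have "(f has_derivative frechet_derivative f (at \<rho> within rho_space)) (at \<rho> within rho_space)"
    using assms(1) frechet_derivative_works differentiable_def by blast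
  then show ?thesis
    using rho_space_derivative_unique[OF _ assms] by (simp add: jacobian_def)
qed

lemma has_derivative_slice_fst:
  assumes "(f has_derivative f') (at (a, b) within A \<times> B)" and "b \<in> B"
  shows "((\<lambda>x. f (x, b)) has_derivative (\<lambda>h. f' (h, 0))) (at a within A)"
proof (rule has_derivative_in_compose[where f = "\<lambda>x. (x, b)"])
  show "((\<lambda>x. (x, b)) has_derivative (\<lambda>h. (h, 0))) (at a within A)"
    by (intro derivative_intros)
  show "(f has_derivative f') (at (a, b) within (\<lambda>x. (x, b)) ` A)"
    using assms(1) by (rule has_derivative_subset) (use assms(2) in auto)
qed

lemma has_derivative_slice_snd:
  assumes "(f has_derivative f') (at (a, b) within A \<times> B)" and "a \<in> A"
  shows "((\<lambda>x. f (a, x)) has_derivative (\<lambda>h. f' (0, h))) (at b within B)"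
proof (rule has_derivative_in_compose[where f = "\<lambda>x. (a, x)"])
  show "((\<lambda>x. (a, x)) has_derivative (\<lambda>h. (0, h))) (at b within B)"
    by (intro derivative_intros)
  show "(f has_derivative f') (at (a, b) within (\<lambda>x. (a, x)) ` B)"
    using assms(1) by (rule has_derivative_subset) (use assms(2) in auto)
qed

lemma has_derivative_vec_lambda:
  fixes f :: "'a::real_normed_vector \<Rightarrow> 'n::finite \<Rightarrow> real"
  assumes "\<And>i. ((\<lambda>x. f x i) has_derivative (\<lambda>h. f' h i)) (at x within S)"
  shows "((\<lambda>x. \<chi> i. f x i) has_derivative (\<lambda>h. \<chi> i. f' h i)) (at x within S)"
  unfolding has_derivative_componentwise_within[of "\<lambda>x. \<chi> i. f x i"]
  using assms by (auto simp: Basis_vec_def inner_axis)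

text \<open>The derivative hypothesis is a convenient source of the linearity of
  \<open>f\<close>.\<close>

lemma matrix_apply:
  fixes f :: "real^'n \<Rightarrow> real^'k"
  assumes "(g has_derivative f) F"
  shows "matrix f *v x = f x"
  using has_derivative_linear[OF assms] by simp

lemma matrix_vector_mult_sum_rdistrib: "(\<Sum>i\<in>S. A i) *v x = (\<Sum>i\<in>S. A i *v x)"
  by (induction S rule: infinite_finite_induct) (simp_all add: matrix_vector_mult_add_rdistrib)

lemma matrix_vector_mult_minus_left: "(- A) *v x = - (A *v x)" for A :: "'a::ring_1^'n^'m"
  by (simp add: matrix_vector_mult_def vec_eq_iff sum_negf)

text \<open>
  \<open>dF\<close> and \<open>ddF\<close> are the first and second derivatives of the residuals in coordinates.  For every \<open>j\<close>, the
  \<open>j\<close>-th component of \<open>g\<close> is \<open>dF p (axis j 1, 0) \<bullet> F (orbit_coord p)\<close>.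
\<close>

locale residual_derivatives =
  fixes F :: "orbit \<Rightarrow> real^'m"
    and dF :: "coords \<Rightarrow> coords \<Rightarrow>\<^sub>L (real^'m)"
    and ddF :: "coords \<Rightarrow> coords \<Rightarrow>\<^sub>L coords \<Rightarrow>\<^sub>L (real^'m)"
  assumes dF: "p \<in> attr_dom \<times> rho_space \<Longrightarrow>
      ((\<lambda>p. F (orbit_coord p)) has_derivative blinfun_apply (dF p)) (at p within attr_dom \<times> rho_space)"
    and ddF: "p \<in> attr_dom \<times> rho_space \<Longrightarrow>
      (dF has_derivative blinfun_apply (ddF p)) (at p within attr_dom \<times> rho_space)"
    and continuous_ddF: "continuous_on (attr_dom \<times> rho_space) ddF"
begin

section \<open>The matrices of the problem in terms of \<open>dF\<close> and
  \<open>ddF\<close>\<close>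

lemma residual_has_derivative_attr:
  assumes "a \<in> attr_dom" and "\<rho> \<in> rho_space"
  shows "((\<lambda>a'. F (attr_coord a', \<rho>)) has_derivative (\<lambda>h. dF (a, \<rho>) (h, 0))) (at a)"
proof -
  have "((\<lambda>a'. F (orbit_coord (a', \<rho>))) has_derivative (\<lambda>h. dF (a, \<rho>) (h, 0))) (at a within attr_dom)"
    using assms by (intro has_derivative_slice_fst[OF dF]) auto
  then show ?thesis
    using at_within_open[OF assms(1) open_attr_dom] by (simp add: orbit_coord_def)
qed

lemma residual_has_derivative_rho:
  assumes "a \<in> attr_dom" and "\<rho> \<in> rho_space"
  shows "((\<lambda>\<rho>'. F (attr_coord a, \<rho>')) has_derivative (\<lambda>k. dF (a, \<rho>) (0, k))) (at \<rho> within rho_space)"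
proof -
  have "((\<lambda>\<rho>'. F (orbit_coord (a, \<rho>'))) has_derivative (\<lambda>k. dF (a, \<rho>) (0, k))) (at \<rho> within rho_space)"
    using assms by (intro has_derivative_slice_snd[OF dF]) auto
  then show ?thesis
    by (simp add: orbit_coord_def)
qed

lemma dresid_attr_eq:
  assumes "a \<in> attr_dom" and "\<rho> \<in> rho_space"
  shows "dresid_attr F a \<rho> = matrix (\<lambda>h. dF (a, \<rho>) (h, 0))"
  unfolding dresid_attr_def by (rule jacobian_eq_matrix) (rule residual_has_derivative_attr[OF assms])

text \<open>Each entry of the row is a bounded linear functional of \<open>dF p\<close>, so its
  derivative comes from \<open>ddF\<close>. The derivative is taken jointly in \<open>p\<close>;
  slicing then yields both derivatives that occur in the neglected terms.\<close>

lemma dresid_attr_row_has_derivative: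
  assumes "p \<in> attr_dom \<times> rho_space"
  shows "((\<lambda>p. dresid_attr F (fst p) (snd p) $ i) has_derivative
      (\<lambda>q. \<chi> j. ddF p q (axis j 1, 0) $ i)) (at p within attr_dom \<times> rho_space)"
proof -
  have "((\<lambda>p. dF p (axis j 1, 0) $ i) has_derivative (\<lambda>q. ddF p q (axis j 1, 0) $ i))
      (at p within attr_dom \<times> rho_space)" for j
    by (rule bounded_linear.has_derivative[OF bounded_linear_vec_nth])
      (rule bounded_linear.has_derivative[OF blinfun.bounded_linear_left ddF[OF assms]])
  then have "((\<lambda>p. \<chi> j. dF p (axis j 1, 0) $ i) has_derivative (\<lambda>q. \<chi> j. ddF p q (axis j 1, 0) $ i))
      (at p within attr_dom \<times> rho_space)"
    by (rule has_derivative_vec_lambda)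
  then show ?thesis
    by (rule has_derivative_transform[OF assms, rotated])
      (auto simp: dresid_attr_eq matrix_def vec_eq_iff)
qed

lemma B_attr_mult:
  assumes "A \<in> attr_space" and "\<rho> \<in> rho_space"
  shows "B_attr F (A, \<rho>) *v h = dF (attr_lift A, \<rho>) (h, 0)"
proof -
  have a: "attr_lift A \<in> attr_dom"
    using assms(1) attr_coord_in_attr_space_iff[of "attr_lift A"] by (simp add: attr_coord_attr_lift)
  show ?thesis
    using matrix_apply[OF residual_has_derivative_attr[OF a assms(2)]]
    by (simp add: B_attr_def dresid_attr_eq a assms(2))
qed

lemma B_rho_mult:
  assumes "A \<in> attr_space" and "\<rho> \<in> rho_space"
  shows "B_rho F (A, \<rho>) *v k = dF (attr_lift A, \<rho>) (0, k)"
proof -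
  have a: "attr_lift A \<in> attr_dom"
    using assms(1) attr_coord_in_attr_space_iff[of "attr_lift A"] by (simp add: attr_coord_attr_lift)
  note der = residual_has_derivative_rho[OF a assms(2)]
  show ?thesis
    using matrix_apply[OF der] jacobian_rho_space_eq_matrix[OF der assms(2)]
    by (simp add: B_rho_def attr_coord_attr_lift[OF assms(1)])
qed

text \<open>Weighting the row derivatives by the residuals and summing over \<open>i\<close>
  produces an inner product. The first argument of \<open>ddF\<close> is the direction of
  differentiation and the second is the slot of \<open>dF\<close>, exactly as in the product rule
  for \<open>g\<close>.\<close>

lemma neglected_attr_mult:
  assumes "A \<in> attr_space" and "\<rho> \<in> rho_space"
  shows "(neglected_attr F (A, \<rho>) *v h) $ j = ddF (attr_lift A, \<rho>) (h, 0) (axis j 1, 0) \<bullet> F (A, \<rho>)"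
proof -
  have a: "attr_lift A \<in> attr_dom"
    using assms(1) attr_coord_in_attr_space_iff[of "attr_lift A"] by (simp add: attr_coord_attr_lift)
  have der: "((\<lambda>a'. dresid_attr F a' \<rho> $ i) has_derivative
      (\<lambda>h. \<chi> j. ddF (attr_lift A, \<rho>) (h, 0) (axis j 1, 0) $ i)) (at (attr_lift A))" for i
    using has_derivative_slice_fst[OF dresid_attr_row_has_derivative[of "(attr_lift A, \<rho>)" i]] a assms(2)
    by (simp add: at_within_open[OF a open_attr_dom])
  have "jacobian (\<lambda>a'. dresid_attr F a' \<rho> $ i) (at (attr_lift A)) *v h
      = (\<chi> j. ddF (attr_lift A, \<rho>) (h, 0) (axis j 1, 0) $ i)" for i
    unfolding jacobian_eq_matrix[OF der] by (rule matrix_apply[OF der])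
  then show ?thesis
    by (simp add: neglected_attr_def matrix_vector_mult_sum_rdistrib scaleR_matrix_vector_assoc[symmetric]
        inner_vec_def mult.commute)
qed

lemma neglected_rho_mult:
  assumes "A \<in> attr_space" and "\<rho> \<in> rho_space"
  shows "(neglected_rho F (A, \<rho>) *v k) $ j = ddF (attr_lift A, \<rho>) (0, k) (axis j 1, 0) \<bullet> F (A, \<rho>)"
proof -
  have a: "attr_lift A \<in> attr_dom"
    using assms(1) attr_coord_in_attr_space_iff[of "attr_lift A"] by (simp add: attr_coord_attr_lift)
  have der: "((\<lambda>\<rho>'. dresid_attr F (attr_lift A) \<rho>' $ i) has_derivative
      (\<lambda>k. \<chi> j. ddF (attr_lift A, \<rho>) (0, k) (axis j 1, 0) $ i)) (at \<rho> within rho_space)" for i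
    using has_derivative_slice_snd[OF dresid_attr_row_has_derivative[of "(attr_lift A, \<rho>)" i]] a assms(2)
    by simp
  have "jacobian (\<lambda>\<rho>'. dresid_attr F (attr_lift A) \<rho>' $ i) (at \<rho> within rho_space) *v k
      = (\<chi> j. ddF (attr_lift A, \<rho>) (0, k) (axis j 1, 0) $ i)" for i
    unfolding jacobian_rho_space_eq_matrix[OF der assms(2)] by (rule matrix_apply[OF der])
  then show ?thesis
    by (simp add: neglected_rho_def matrix_vector_mult_sum_rdistrib scaleR_matrix_vector_assoc[symmetric]
        inner_vec_def mult.commute)
qed

text \<open>Fermat's rule for the squared norm of the residuals in coordinates, whose derivative is
  twice this inner product.\<close>

lemma local_minimiser_stationary:
  assumes min: "local_minimiser F \<rho> (attr_coord a)" and \<rho>: "\<rho> \<in> rho_space"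
  shows "dF (a, \<rho>) (h, 0) \<bullet> F (attr_coord a, \<rho>) = 0"
proof -
  have a: "a \<in> attr_dom"
    using min by (simp add: local_minimiser_def attr_coord_in_attr_space_iff)
  note der = residual_has_derivative_attr[OF a \<rho>]
  have der_norm: "((\<lambda>a'. F (attr_coord a', \<rho>) \<bullet> F (attr_coord a', \<rho>)) has_derivative
      (\<lambda>h. F (attr_coord a, \<rho>) \<bullet> dF (a, \<rho>) (h, 0) + dF (a, \<rho>) (h, 0) \<bullet> F (attr_coord a, \<rho>))) (at a)"
    by (rule has_derivative_inner[OF der der])
  obtain U where U: "open U" "attr_coord a \<in> U"
    "\<And>A'. A' \<in> U \<Longrightarrow> A' \<noteq> attr_coord a \<Longrightarrow> A' \<in> attr_space \<Longrightarrow> Q F (attr_coord a, \<rho>) \<le> Q F (A', \<rho>)"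
    using min unfolding local_minimiser_def eventually_at_topological by blast
  have "\<forall>\<^sub>F a' in at a. attr_coord a' \<in> U"
    using isCont_attr_coord[of a] U(1,2) unfolding continuous_at by (rule topological_tendstoD)
  moreover have "\<forall>\<^sub>F a' in at a. a' \<in> attr_dom"
    using open_attr_dom a by (rule eventually_at_in_open')
  ultimately have "\<forall>\<^sub>F a' in at a. F (attr_coord a, \<rho>) \<bullet> F (attr_coord a, \<rho>) \<le> F (attr_coord a', \<rho>) \<bullet> F (attr_coord a', \<rho>)"
  proof eventually_elim
    case (elim a')
    \<comment> \<open>\<open>U(3)\<close> concerns other attributables only, while \<open>a'\<close>
      could represent the same one; hence the case distinction.\<close>
    then have "Q F (attr_coord a, \<rho>) \<le> Q F (attr_coord a', \<rho>)"
      using U(3)[of "attr_coord a'"] by (cases "attr_coord a' = attr_coord a") (auto simp: attr_coord_in_attr_space_iff)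
    then show ?case
      by (simp add: Q_def divide_le_cancel)
  qed
  from has_derivative_local_min[OF der_norm this]
  show ?thesis
    by (auto dest!: fun_cong[of _ _ h] simp: inner_commute)
qed

text \<open>In this product rule the first term leads to \<open>C_attr\<close> and to the product
  with \<open>B_rho\<close>; the second is the one to be neglected.\<close>

lemma stationarity_has_derivative:
  assumes "p \<in> attr_dom \<times> rho_space"
  shows "((\<lambda>p. dF p e \<bullet> F (orbit_coord p)) has_derivative
      (\<lambda>q. dF p e \<bullet> dF p q + ddF p q e \<bullet> F (orbit_coord p))) (at p within attr_dom \<times> rho_space)"
  by (rule has_derivative_inner[OF bounded_linear.has_derivative[OF blinfun.bounded_linear_left ddF[OF assms]] dF[OF assms]])

text \<open>Along a lift of the graph every component of \<open>g\<close> vanishes identically near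
  \<open>\<rho>\<close>, so its derivative, computed by the chain rule, is zero.\<close>

lemma linearised_stationarity_interior:
  assumes rho: "K \<subseteq> rho_space" and min: "\<And>\<rho>. \<rho> \<in> K \<Longrightarrow> local_minimiser F \<rho> (Astar \<rho>)"
    and D: "has_coord_derivative (f_mu Astar) D \<rho> K" and \<rho>: "\<rho> \<in> interior K"
    and p: "orbit_coord p = f_mu Astar \<rho>"
  shows "dF p (axis j 1, 0) \<bullet> dF p (D k) + ddF p (D k) (axis j 1, 0) \<bullet> F (orbit_coord p) = 0"
proof -
  obtain l where l: "(l has_derivative blinfun_apply D) (at \<rho> within K)" "l \<rho> = p"
    "\<forall>\<^sub>F v in at \<rho> within K. orbit_coord (l v) = f_mu Astar v"
    using has_coord_derivative_lift_at[OF D p] .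
  obtain V where V: "open V" "\<rho> \<in> V"
    "\<And>v. v \<in> V \<Longrightarrow> v \<noteq> \<rho> \<Longrightarrow> v \<in> K \<Longrightarrow> orbit_coord (l v) = f_mu Astar v"
    using l(3) unfolding eventually_at_topological by blast
  \<comment> \<open>On an open neighbourhood inside \<open>K\<close> the derivative is the ordinary
    one and hence unique.\<close>
  define U where "U = V \<inter> interior K"
  have U: "open U" "\<rho> \<in> U" "U \<subseteq> K"
    using V \<rho> interior_subset[of K] by (auto simp: U_def)
  have lift: "orbit_coord (l v) = f_mu Astar v" if "v \<in> U" for v
    using V(3)[of v] that U(3) l(2) p by (cases "v = \<rho>") (auto simp: U_def)
  have coords: "snd (l v) = v" "attr_coord (fst (l v)) = Astar v" if "v \<in> U" for v
    using lift[OF that] by (auto simp: orbit_coord_def f_mu_def)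
  have lU: "l v \<in> attr_dom \<times> rho_space" if "v \<in> U" for v
  proof -
    have "attr_coord (fst (l v)) \<in> attr_space"
      using min[of v] U(3) that coords(2)[OF that] by (auto simp: local_minimiser_def)
    then show ?thesis
      using coords(1)[OF that] that U(3) rho by (auto simp: mem_Times_iff attr_coord_in_attr_space_iff)
  qed
  have zero: "dF (l v) (axis j 1, 0) \<bullet> F (orbit_coord (l v)) = 0" if "v \<in> U" for v
  proof -
    have "local_minimiser F v (attr_coord (fst (l v)))" "v \<in> rho_space"
      using min[of v] U(3) rho that coords(2)[OF that] by auto
    then have "dF (fst (l v), v) (axis j 1, 0) \<bullet> F (attr_coord (fst (l v)), v) = 0"
      by (rule local_minimiser_stationary)
    moreover have "(fst (l v), v) = l v"
      using coords(1)[OF that] by (metis prod.collapse)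
    moreover have "(attr_coord (fst (l v)), v) = orbit_coord (l v)"
      using coords(1)[OF that] by (simp add: orbit_coord_def)
    ultimately show ?thesis
      by simp
  qed
  have "((\<lambda>v. dF (l v) (axis j 1, 0) \<bullet> F (orbit_coord (l v))) has_derivative
      (\<lambda>k. dF (l \<rho>) (axis j 1, 0) \<bullet> dF (l \<rho>) (D k) + ddF (l \<rho>) (D k) (axis j 1, 0) \<bullet> F (orbit_coord (l \<rho>))))
      (at \<rho> within U)"
  proof (rule has_derivative_in_compose[where f = l and g = "\<lambda>p. dF p (axis j 1, 0) \<bullet> F (orbit_coord p)"
        and g' = "\<lambda>q. dF (l \<rho>) (axis j 1, 0) \<bullet> dF (l \<rho>) q + ddF (l \<rho>) q (axis j 1, 0) \<bullet> F (orbit_coord (l \<rho>))"])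
    show "(l has_derivative blinfun_apply D) (at \<rho> within U)"
      using l(1) U(3) by (rule has_derivative_subset)
    show "((\<lambda>p. dF p (axis j 1, 0) \<bullet> F (orbit_coord p)) has_derivative
        (\<lambda>q. dF (l \<rho>) (axis j 1, 0) \<bullet> dF (l \<rho>) q + ddF (l \<rho>) q (axis j 1, 0) \<bullet> F (orbit_coord (l \<rho>))))
        (at (l \<rho>) within l ` U)"
      using stationarity_has_derivative[OF lU[OF U(2)]] by (rule has_derivative_subset) (use lU in blast)
  qed
  then have "((\<lambda>v. 0) has_derivative
      (\<lambda>k. dF p (axis j 1, 0) \<bullet> dF p (D k) + ddF p (D k) (axis j 1, 0) \<bullet> F (orbit_coord p))) (at \<rho> within U)"
    unfolding l(2) by (rule has_derivative_transform[OF U(2), rotated]) (simp add: zero)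
  then have "(\<lambda>k. dF p (axis j 1, 0) \<bullet> dF p (D k) + ddF p (D k) (axis j 1, 0) \<bullet> F (orbit_coord p)) = (\<lambda>k. 0)"
    unfolding at_within_open[OF U(2,1)] by (rule has_derivative_unique) (rule has_derivative_const)
  then show ?thesis
    by (rule fun_cong)
qed

text \<open>A lift is known to be continuous only at its base point, so
  \<open>continuous_on_eq_from_interior\<close> does not apply directly. Instead the interior
  identity is passed to the limit along one lift.\<close>

lemma linearised_stationarity:
  assumes rho: "K \<subseteq> rho_space" and min: "\<And>\<rho>. \<rho> \<in> K \<Longrightarrow> local_minimiser F \<rho> (Astar \<rho>)"
    and dom: "param_domain K" and C1: "C1_with K (f_mu Astar) D" and \<rho>: "\<rho> \<in> K"
    and p: "orbit_coord p = f_mu Astar \<rho>"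
  shows "dF p (axis j 1, 0) \<bullet> dF p (D \<rho> k) + ddF p (D \<rho> k) (axis j 1, 0) \<bullet> F (orbit_coord p) = 0"
proof -
  let ?S = "attr_dom \<times> rho_space"
  have nontriv: "at \<rho> within interior K \<noteq> bot"
  proof (cases "\<rho> \<in> interior K")
    case True
    then have "\<rho> islimpt interior K"
      by (simp add: open_imp_islimpt)
    then show ?thesis
      by (simp add: trivial_limit_within)
  next
    case False
    then have "\<rho> islimpt interior K"
      using dom \<rho> by (auto simp: param_domain_def closure_def)
    then show ?thesis
      by (simp add: trivial_limit_within)
  qed
  have D: "has_coord_derivative (f_mu Astar) (D v) v K" if "v \<in> K" for v
    using C1 that by (simp add: C1_with_def)
  obtain l where l: "(l has_derivative blinfun_apply (D \<rho>)) (at \<rho> within K)" "l \<rho> = p"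
    "\<forall>\<^sub>F v in at \<rho> within K. orbit_coord (l v) = f_mu Astar v"
    using has_coord_derivative_lift_at[OF D[OF \<rho>] p] .
  have le: "at \<rho> within interior K \<le> at \<rho> within K"
    by (intro at_le interior_subset)
  have in_S: "q \<in> ?S" if "orbit_coord q = f_mu Astar v" "v \<in> K" for q v
  proof -
    have q: "attr_coord (fst q) = Astar v" "snd q = v"
      using that(1) by (auto simp: orbit_coord_def f_mu_def)
    then have "attr_coord (fst q) \<in> attr_space"
      using min[OF that(2)] by (simp add: local_minimiser_def)
    then show ?thesis
      using q(2) that(2) rho by (auto simp: mem_Times_iff attr_coord_in_attr_space_iff)
  qed
  have ev: "\<forall>\<^sub>F v in at \<rho> within interior K. orbit_coord (l v) = f_mu Astar v \<and> v \<in> interior K"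
    using filter_leD[OF le l(3)] by (auto simp: eventually_at_filter elim: eventually_mono)
  \<comment> \<open>Continuity of \<open>dF\<close>, \<open>ddF\<close> and the residuals is
    available on \<open>?S\<close> only, so the lift has to stay there eventually.\<close>
  then have ev_S: "\<forall>\<^sub>F v in at \<rho> within interior K. l v \<in> ?S"
    by eventually_elim (use in_S interior_subset in blast)
  have l_lim: "(l \<longlongrightarrow> p) (at \<rho> within interior K)"
    using has_derivative_continuous[OF l(1)] l(2) le
    by (auto simp: continuous_within intro: tendsto_mono)
  have lim: "((\<lambda>v. u (l v)) \<longlongrightarrow> u p) (at \<rho> within interior K)" if "continuous_on ?S u"
    for u :: "coords \<Rightarrow> 'z::topological_space"
    by (rule continuous_on_tendsto_compose[OF that l_lim in_S[OF p \<rho>] ev_S])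
  have cont_dF: "continuous_on ?S dF"
    using ddF by (intro has_derivative_continuous_on)
  have cont_F: "continuous_on ?S (\<lambda>p. F (orbit_coord p))"
    using dF by (intro has_derivative_continuous_on)
  have "continuous_on K D"
    using C1 by (simp add: C1_with_def)
  then have D_lim: "(D \<longlongrightarrow> D \<rho>) (at \<rho> within interior K)"
    using \<rho> le by (auto simp: continuous_on_def intro: tendsto_mono)
  let ?G = "\<lambda>q B. dF q (axis j 1, 0) \<bullet> dF q (blinfun_apply B k)
      + ddF q (blinfun_apply B k) (axis j 1, 0) \<bullet> F (orbit_coord q)"
  have "((\<lambda>v. ?G (l v) (D v)) \<longlongrightarrow> ?G p (D \<rho>)) (at \<rho> within interior K)"
    by (intro tendsto_intros lim[OF continuous_ddF] lim[OF cont_dF] lim[OF cont_F] D_lim)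
  \<comment> \<open>The interior identity is applied at \<open>v\<close> with the point
    \<open>l v\<close> over \<open>f_mu Astar v\<close>; differentiability of \<open>l\<close> at
    \<open>v\<close> does not enter.\<close>
  moreover have "\<forall>\<^sub>F v in at \<rho> within interior K. ?G (l v) (D v) = 0"
    using ev
  proof eventually_elim
    case (elim v)
    then show ?case
      using linearised_stationarity_interior[OF rho min D] interior_subset by blast
  qed
  ultimately have "((\<lambda>v. 0) \<longlongrightarrow> ?G p (D \<rho>)) (at \<rho> within interior K)"
    by (rule Lim_transform_eventually)
  then show ?thesis
    using tendsto_unique[OF nontriv _ tendsto_const] by blast
qed

text \<open>Splitting \<open>D \<rho> k\<close> into its attributable part and its
  \<open>\<rho>\<close> part and dropping the neglected terms leaves a normal equation with matrix
  \<open>C_attr\<close>, which is then inverted.\<close>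

lemma dAstar_eq:
  assumes rho: "K \<subseteq> rho_space" and min: "\<And>\<rho>. \<rho> \<in> K \<Longrightarrow> local_minimiser F \<rho> (Astar \<rho>)"
    and dom: "param_domain K" and C1: "C1_with K (f_mu Astar) D" and \<rho>: "\<rho> \<in> K"
    and inv: "invertible (C_attr F (Astar \<rho>, \<rho>))"
    and neglect: "neglected_attr F (Astar \<rho>, \<rho>) = 0" "neglected_rho F (Astar \<rho>, \<rho>) = 0"
  shows "dAstar D \<rho> = - (matrix_inv (C_attr F (Astar \<rho>, \<rho>)) ** transpose (B_attr F (Astar \<rho>, \<rho>))
      ** B_rho F (Astar \<rho>, \<rho>))"
proof -
  let ?x = "(Astar \<rho>, \<rho>)" and ?p = "(attr_lift (Astar \<rho>), \<rho>)"
  have A: "Astar \<rho> \<in> attr_space" and \<rho>': "\<rho> \<in> rho_space"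
    using min[OF \<rho>] rho \<rho> by (auto simp: local_minimiser_def)
  have p: "orbit_coord ?p = f_mu Astar \<rho>"
    by (simp add: orbit_coord_def f_mu_def attr_coord_attr_lift[OF A])
  \<comment> \<open>Component \<open>j\<close> pairs \<open>y\<close> with column \<open>j\<close>
    of \<open>B_attr\<close>, which is the image of \<open>axis j 1\<close> under
    \<open>dF\<close>.\<close>
  have transpose_mult: "(transpose (B_attr F ?x) *v y) $ j = dF ?p (axis j 1, 0) \<bullet> y" for y j
  proof -
    have "(transpose (B_attr F ?x) *v y) $ j = axis j 1 \<bullet> (transpose (B_attr F ?x) *v y)"
      by (simp add: inner_axis')
    also have "\<dots> = (B_attr F ?x *v axis j 1) \<bullet> y"
      using dot_lmul_matrix[of y "B_attr F ?x" "axis j 1"] by (simp add: inner_commute)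
    finally show ?thesis
      by (simp add: B_attr_mult[OF A \<rho>'])
  qed
  have normal: "C_attr F ?x *v (dAstar D \<rho> *v k) = - (transpose (B_attr F ?x) *v (B_rho F ?x *v k))" for k
  proof -
    have "linear (\<lambda>h. fst (D \<rho> h))"
      by (intro bounded_linear.linear bounded_linear_intros)
    then have dA: "dAstar D \<rho> *v k = fst (D \<rho> k)"
      unfolding dAstar_def by simp
    have "snd (D \<rho> k) = k"
      using graph_derivative_snd[OF dom C1 _ \<rho>] by (simp add: f_mu_def)
    then have "D \<rho> k = (dAstar D \<rho> *v k, 0) + (0, k)"
      by (simp add: dA prod_eq_iff)
    moreover have "ddF ?p (dAstar D \<rho> *v k, 0) (axis j 1, 0) \<bullet> F ?x = 0" for j
      using neglected_attr_mult[OF A \<rho>'] neglect(1) by (metis matrix_vector_mult_0 zero_index)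
    moreover have "ddF ?p (0, k) (axis j 1, 0) \<bullet> F ?x = 0" for j
      using neglected_rho_mult[OF A \<rho>'] neglect(2) by (metis matrix_vector_mult_0 zero_index)
    moreover have "orbit_coord ?p = ?x"
      using p by (simp add: f_mu_def)
    ultimately have "dF ?p (axis j 1, 0) \<bullet> dF ?p (dAstar D \<rho> *v k, 0)
        + dF ?p (axis j 1, 0) \<bullet> dF ?p (0, k) = 0" for j
      using linearised_stationarity[OF rho min dom C1 \<rho> p, of j k]
      by (simp only: blinfun.add_right blinfun.add_left inner_add_left inner_add_right) simp
    then have "(C_attr F ?x *v (dAstar D \<rho> *v k)) $ j = - (transpose (B_attr F ?x) *v (B_rho F ?x *v k)) $ j" for j
      by (simp add: C_attr_def transpose_mult B_attr_mult[OF A \<rho>'] B_rho_mult[OF A \<rho>']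
          eq_neg_iff_add_eq_0 del: transpose_matrix_vector flip: matrix_vector_mul_assoc)
    then show ?thesis
      by (simp add: vec_eq_iff)
  qed
  have inv_left: "matrix_inv (C_attr F ?x) ** C_attr F ?x = mat 1"
    using inv unfolding invertible_def matrix_inv_def by (rule someI2_ex) simp
  have "dAstar D \<rho> *v k = - (matrix_inv (C_attr F ?x) ** transpose (B_attr F ?x) ** B_rho F ?x) *v k" for k
  proof -
    have "dAstar D \<rho> *v k = matrix_inv (C_attr F ?x) *v (C_attr F ?x *v (dAstar D \<rho> *v k))"
      by (metis inv_left matrix_vector_mul_assoc matrix_vector_mul_lid)
    also have "\<dots> = - (matrix_inv (C_attr F ?x) *v (transpose (B_attr F ?x) *v (B_rho F ?x *v k)))"
      unfolding normal by (rule vec.neg)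
    finally show ?thesis
      by (simp add: matrix_vector_mul_assoc matrix_mul_assoc matrix_vector_mult_minus_left)
  qed
  then show ?thesis
    by (simp add: matrix_eq)
qed

end

theorem theorem3p9:
  fixes F :: "orbit \<Rightarrow> real^'m"
    and AR K K' :: "(real^2) set"
    and A0 Astar :: "real^2 \<Rightarrow> attributable"
    and D :: "real^2 \<Rightarrow> (real^2) \<Rightarrow>\<^sub>L coords"
    and P :: "'w measure"
    and X :: "'w \<Rightarrow> orbit"
    and R :: "'w \<Rightarrow> real^2"
  assumes "CARD('m) \<ge> 6"
    and "C2_residuals F"
    and "compact AR" and "AR \<subseteq> rho_space" and "K \<subseteq> AR"
    and "K' = {\<rho>\<in>K. \<exists>A. dc_converges_to F \<rho> (A0 \<rho>) A \<and> local_minimiser F \<rho> A}"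
    and "\<forall>\<rho>\<in>K'. dc_converges_to F \<rho> (A0 \<rho>) (Astar \<rho>) \<and> local_minimiser F \<rho> (Astar \<rho>)"
    and "\<forall>\<rho>\<in>K'. invertible (C_attr F (Astar \<rho>, \<rho>))"
    and "param_domain K'"
    and "C1_with K' (f_mu Astar) D"
    and "\<exists>\<rho>0\<in>K'. \<forall>\<rho>\<in>K'. Q F (f_mu Astar \<rho>0) \<le> Q F (f_mu Astar \<rho>)"
    and "prob_space P"
    and "\<exists>c>0. distributed P (surface_measure (f_mu Astar ` K')) X
           (\<lambda>x. ennreal (c * exp (- (chi F K' Astar x)\<^sup>2 / 2)))"
    and "R \<in> borel_measurable P"
    and "\<forall>\<omega>\<in>space P. R \<omega> \<in> K' \<and> f_mu Astar (R \<omega>) = X \<omega>"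
  shows "distributed P lborel R
           (\<lambda>\<rho>. ennreal (indicator K' \<rho> *
              (exp (- (chi F K' Astar (f_mu Astar \<rho>))\<^sup>2 / 2) * sqrt (G_mu D \<rho>) /
               (LINT \<rho>':K'|lborel.
                  exp (- (chi F K' Astar (f_mu Astar \<rho>'))\<^sup>2 / 2) * sqrt (G_mu D \<rho>')))))
       \<and> (\<forall>\<rho>\<in>K'.
            neglected_attr F (Astar \<rho>, \<rho>) = 0 \<and> neglected_rho F (Astar \<rho>, \<rho>) = 0 \<longrightarrow>
            dAstar D \<rho> =
              - (matrix_inv (C_attr F (Astar \<rho>, \<rho>)) ** transpose (B_attr F (Astar \<rho>, \<rho>))
                 ** B_rho F (Astar \<rho>, \<rho>)))"
proof -
  have graph: "snd (f_mu Astar \<rho>) = \<rho>" for \<rho>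
    by (simp add: f_mu_def)
  \<comment> \<open>The two Gramians are identified on \<open>K'\<close> only, which is enough under
    the indicator and under the integral over \<open>K'\<close>.\<close>
  have G: "G_mu D \<rho> = gram_det (D \<rho>)" if "\<rho> \<in> K'" for \<rho>
    unfolding G_mu_def dAstar_def
    by (rule gram_det_graph[symmetric]) (rule graph_derivative_snd[OF assms(9,10) graph that])
  let ?q = "\<lambda>x. exp (- (chi F K' Astar x)\<^sup>2 / 2)"
  obtain c where c: "0 < c" "distributed P (surface_measure (f_mu Astar ` K')) X (\<lambda>x. ennreal (c * ?q x))"
    using assms(13) by blast
  have "(LINT \<rho>:K'|lborel. ?q (f_mu Astar \<rho>) * sqrt (G_mu D \<rho>))
      = (LINT \<rho>:K'|lborel. ?q (f_mu Astar \<rho>) * sqrt (gram_det (D \<rho>)))"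
    by (intro set_lebesgue_integral_cong) (use assms(9) G in \<open>auto simp: param_domain_def\<close>)
  moreover have "indicator K' \<rho> * (?q (f_mu Astar \<rho>) * sqrt (G_mu D \<rho>) / I)
      = indicator K' \<rho> * (?q (f_mu Astar \<rho>) * sqrt (gram_det (D \<rho>)) / I)" for \<rho> and I :: real
    using G by (simp add: indicator_def)
  moreover have "distributed P lborel R
     (\<lambda>\<rho>. ennreal (indicator K' \<rho> * (?q (f_mu Astar \<rho>) * sqrt (gram_det (D \<rho>)) /
        (LINT \<rho>':K'|lborel. ?q (f_mu Astar \<rho>') * sqrt (gram_det (D \<rho>'))))))"
    using assms(15)
    by (intro distributed_graph_parameter[OF assms(12,9,10) graph c(1) _ c(2) assms(14)]) auto
  ultimately have density: "distributed P lborel R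
     (\<lambda>\<rho>. ennreal (indicator K' \<rho> * (?q (f_mu Astar \<rho>) * sqrt (G_mu D \<rho>) /
        (LINT \<rho>':K'|lborel. ?q (f_mu Astar \<rho>') * sqrt (G_mu D \<rho>')))))"
    by (simp only:)
  \<comment> \<open>\<open>C2_residuals\<close> unfolds to the existence of exactly the data of the
    locale.\<close>
  obtain dF :: "coords \<Rightarrow> coords \<Rightarrow>\<^sub>L (real^'m)" and ddF where "residual_derivatives F dF ddF"
    using assms(2) unfolding C2_residuals_def C2_on_def C1_on_def residual_derivatives_def by blast
  then interpret residual_derivatives F dF ddF .
  have "K' \<subseteq> rho_space"
    using assms(4,5,6) by auto
  then have "dAstar D \<rho> = - (matrix_inv (C_attr F (Astar \<rho>, \<rho>)) ** transpose (B_attr F (Astar \<rho>, \<rho>))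
      ** B_rho F (Astar \<rho>, \<rho>))"
    if "\<rho> \<in> K'" "neglected_attr F (Astar \<rho>, \<rho>) = 0" "neglected_rho F (Astar \<rho>, \<rho>) = 0" for \<rho>
    using assms(7,8) that by (intro dAstar_eq[OF _ _ assms(9,10)]) auto
  with density show ?thesis
    by blast
qed

end
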